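(* Let $d\in\mathbb{Q}$, $\ell\in\mathbb{N}$, $z\in\mathbb{C}$, and write $z=(z_0+j)/\ell$ with $j\in\mathbb{Z}$, $z_0=x_0+iy_0$, $x_0,y_0\in\mathbb{R}$, $-1/2<x_0\le1/2$. As $t\to0^+$, for every $N\in\mathbb{N}_0$: (i) If $\operatorname{Im}(z)>0$, or ($\operatorname{Im}(z)<0$ and $|x_0|>|y_0|$), or $z\in\mathbb{R}\setminus\frac1\ell\mathbb{Z}$, then $$G_{d,\ell}(z;it)=2i\sum_{a=0}^N\mathcal{D}_z^{2a}\left(\frac{\sin(2\pi dz)}{1-\zeta^\ell}\right)\frac{(-2\pi t)^a}{a!}+O\left(t^{N+1}\right).$$ (ii) If $\operatorname{Im}(z)<0$ and $|x_0|\le|y_0|$, then $$G_{d,\ell}(z;it)=2i\left(2\ell^2t\right)^{-\frac12}e^{-\frac{\pi z_0^2}{2\ell^2t}}\sum_{\substack{n\in\mathbb{Z}\\|n+x_0|\le|y_0|}}e^{-\frac{\pi n^2}{2\ell^2t}-\frac{\pi z_0n}{\ell^2t}}\sin\left(\frac{2\pi d}{\ell}(j-n)\right)+2i\sum_{a=0}^N\mathcal{D}_z^{2a}\left(\frac{\sin(2\pi dz)}{1-\zeta^\ell}\right)\frac{(-2\pi t)^a}{a!}+O\left(t^{N+1}\right).$$ (iii) If $z\in\frac1\ell\mathbb{Z}$, then $$G_{d,\ell}(z;it)=\frac{i\sin(2\pi dz)}{\ell(2t)^{1/2}}-\sum_{a=0}^N\left(\zeta^dB_{2a+1}\left(\frac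 d\ell\right)-\zeta^{-d}B_{2a+1}\left(-\frac d\ell\right)\right)\frac{\left(-2\pi\ell^2t\right)^a}{a!(2a+1)}+O\left(t^{N+1}\right).$$
   Context: For $z\in\mathbb{C}$, $\tau$ in the upper half-plane, $\zeta^x:=e^{2\pi ixz}$, $q^x:=e^{2\pi ix\tau}$ ($x\in\mathbb{Q}$). $F_{d,\ell}(z;\tau):=\sum_{n\ge0}\zeta^{\ell n+d}q^{(\ell n+d)^2}$ and $G_{d,\ell}(z;\tau):=F_{d,\ell}(z;\tau)-F_{-d,\ell}(z;\tau)$. $\mathcal{D}_z:=\frac1{2\pi i}\frac{\partial}{\partial z}$; $B_n$ are Bernoulli polynomials. Powers of positive reals are positive. *)

theory Defs
  imports "HOL-Complex_Analysis.Complex_Analysis" "HOL-Library.Landau_Symbols"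
begin

text \<open>
  The common form of the powers of \<open>\<zeta>\<close> and \<open>q\<close>: \<open>\<zeta>\<^sup>x\<close> is \<open>epow x z\<close> and \<open>q\<^sup>x\<close> is \<open>epow x \<tau>\<close>.
\<close>

definition epow :: "rat \<Rightarrow> complex \<Rightarrow> complex" where
  "epow x w = exp (2 * of_real pi * \<i> * of_rat x * w)"

text \<open>The series converges absolutely for \<open>Im \<tau> > 0\<close>, the only case in which it is meaningful.\<close>

definition F :: "rat \<Rightarrow> nat \<Rightarrow> complex \<Rightarrow> complex \<Rightarrow> complex" where
  "F d l z \<tau> = (\<Sum>n. epow (of_nat l * of_nat n + d) z * epow ((of_nat l * of_nat n + d)\<^sup>2) \<tau>)"

definition G :: "rat \<Rightarrow> nat \<Rightarrow> complex \<Rightarrow> complex \<Rightarrow> complex" where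
  "G d l z \<tau> = F d l z \<tau> - F (- d) l z \<tau>"

definition Dz :: "(complex \<Rightarrow> complex) \<Rightarrow> complex \<Rightarrow> complex" where
  "Dz f = (\<lambda>z. 1 / (2 * of_real pi * \<i>) * deriv f z)"

text \<open>
  Bernoulli polynomials, as coefficients of the generating function
  \<open>X e\<^bsup>xX\<^esup> / (e\<^sup>X - 1) = (\<Sum>n. B\<^sub>n(x) X\<^sup>n / n!)\<close>; the quotient of formal power series is exact,
  as both \<open>X\<close> and \<open>e\<^sup>X - 1\<close> have subdegree 1.
\<close>

definition bernoulli_poly :: "nat \<Rightarrow> complex \<Rightarrow> complex" where
  "bernoulli_poly n x = fact n * fps_nth (fps_X * fps_exp x / (fps_exp 1 - 1)) n"

lemma bernoulli_poly_genfun: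
  "Abs_fps (\<lambda>n. bernoulli_poly n x / fact n) * (fps_exp 1 - 1) = fps_X * fps_exp x"
proof -
  have eq: "Abs_fps (\<lambda>n. bernoulli_poly n x / fact n) = fps_X * fps_exp x / (fps_exp 1 - 1)"
    by (simp add: bernoulli_poly_def fps_eq_iff)
  have sub: "subdegree (fps_exp 1 - 1 :: complex fps) = 1"
    by (rule subdegreeI) auto
  have ne: "fps_exp 1 - 1 \<noteq> (0 :: complex fps)"
    using sub by auto
  have "(fps_exp 1 - 1 :: complex fps) dvd fps_X * fps_exp x"
    using sub ne by (subst fps_dvd_iff) auto
  thus ?thesis
    unfolding eq by simp
qed

text \<open>The set \<open>(1/l) \<int>\<close>, as a subset of the complex numbers.\<close>

definition frac_ints :: "nat \<Rightarrow> complex set" where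
  "frac_ints l = {of_int m / of_nat l | m. True}"

end

theory Submission
  imports Defs "HOL-Probability.Probability" "HOL-Real_Asymp.Real_Asymp"
begin

text \<open>
  Up to the factor \<open>\<zeta>\<^sup>d\<close>, \<open>F d l z (\<i> t)\<close> is \<open>S(w, a, s) = (\<Sum>n. w\<^sup>n e\<^bsup>-s(n + a)\<^sup>2\<^esup>)\<close> with
  \<open>w = \<zeta>\<^sup>l\<close>, \<open>a = d/l\<close>, \<open>s = 2\<pi>l\<^sup>2t\<close>. For \<open>|w| \<le> 1\<close> it is expanded by Euler--Maclaurin summation
  twisted by \<open>w\<close>. Let \<open>\<beta>(X) = X e\<^bsup>aX\<^esup> / (w e\<^sup>X - 1)\<close>, \<open>\<phi>(x) = e\<^bsup>-sx\<^sup>2\<^esup>\<close> and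
  \<open>H = \<Sum>k. \<beta>\<^sub>k \<phi>\<^sup>(\<^sup>k\<^sup>-\<^sup>1\<^sup>)\<close>; then \<open>w H(x + 1) - H(x) = \<phi>(x + a)\<close> up to Taylor remainders, so that
  \<open>S = - H(0)\<close> asymptotically. The coefficients of \<open>\<beta>\<close> are Bernoulli polynomials for \<open>w = 1\<close> and
  derivatives of the sine quotient otherwise.

  For \<open>|w| > 1\<close> the terms with \<open>n < 0\<close> form a sum of the same kind for \<open>1/w\<close>, with the same
  expansion up to sign, so \<open>S\<close> is that expansion plus the full theta series. Poisson summation
  turns the latter into a sum of \<open>e\<^bsup>-\<pi>(z\<^sub>0 + n)\<^sup>2 / 2l\<^sup>2t\<^esup>\<close>, which is negligible unless
  \<open>Re ((z\<^sub>0 + n)\<^sup>2) \<le> 0\<close>, that is \<open>|n + x\<^sub>0| \<le> |y\<^sub>0|\<close>.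
\<close>

section \<open>Twisted Euler--Maclaurin summation\<close>

definition apostol_bernoulli_fps :: "complex \<Rightarrow> complex \<Rightarrow> complex fps" where
  "apostol_bernoulli_fps w a = fps_X * fps_exp a / (fps_const w * fps_exp 1 - 1)"

lemma subdegree_fps_const_mult_exp_minus_1:
  "subdegree (fps_const w * fps_exp 1 - 1 :: complex fps) = (if w = 1 then 1 else 0)"
  by (rule subdegreeI) (auto split: if_splits)

lemma fps_const_mult_exp_minus_1_neq_0: "fps_const w * fps_exp 1 - 1 \<noteq> (0 :: complex fps)"
proof
  assume eq: "fps_const w * fps_exp 1 - 1 = (0 :: complex fps)"
  show False
    using arg_cong[OF eq, of "\<lambda>f. fps_nth f 0"] arg_cong[OF eq, of "\<lambda>f. fps_nth f 1"] by simp
qed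

lemma apostol_bernoulli_fps_mult:
  "apostol_bernoulli_fps w a * (fps_const w * fps_exp 1 - 1) = fps_X * fps_exp a"
proof -
  have "fps_const w * fps_exp 1 - 1 dvd fps_X * fps_exp a"
    using subdegree_fps_const_mult_exp_minus_1[of w] fps_const_mult_exp_minus_1_neq_0[of w]
    by (subst fps_dvd_iff) auto
  thus ?thesis by (simp add: apostol_bernoulli_fps_def)
qed

text \<open>The differential operator \<open>b(d/dx)\<close>, truncated to order \<open>K\<close>, applied to the function \<open>f 0\<close>
  with derivatives \<open>f k\<close>.\<close>

definition fps_diff_op :: "nat \<Rightarrow> complex fps \<Rightarrow> (nat \<Rightarrow> real \<Rightarrow> real) \<Rightarrow> real \<Rightarrow> complex" where
  "fps_diff_op K b f x = (\<Sum>k\<le>K. fps_nth b k * of_real (f k x))"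

lemma fps_diff_op_X:
  assumes "K \<ge> 1"
  shows "fps_diff_op K fps_X f x = of_real (f 1 x)"
proof -
  have "fps_diff_op K fps_X f x = (\<Sum>k\<le>K. if k = 1 then complex_of_real (f k x) else 0)"
    unfolding fps_diff_op_def by (intro sum.cong) auto
  thus ?thesis using assms by simp
qed

lemma fps_diff_op_mult_exp:
  "fps_diff_op K (b * fps_exp (of_real h)) f u
    = (\<Sum>k\<le>K. fps_nth b k * of_real (\<Sum>j\<le>K-k. f (k + j) u * h ^ j / fact j))"
proof -
  define T where "T = (\<lambda>k j. fps_nth b k * complex_of_real (f (k + j) u * h ^ j / fact j))"
  have "fps_diff_op K (b * fps_exp (of_real h)) f u = (\<Sum>i\<le>K. \<Sum>k\<le>i. T k (i - k))"
    unfolding fps_diff_op_def T_def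
    by (simp add: fps_mult_nth atLeast0AtMost sum_distrib_left mult_ac)
  also have "\<dots> = (\<Sum>k\<le>K. \<Sum>j\<le>K-k. T k j)"
    unfolding sum.triangle_reindex_eq[symmetric] by (subst sum.Sigma) (auto intro!: sum.cong)
  finally show ?thesis by (simp add: T_def sum_distrib_left)
qed

lemma taylor_remainder_bound:
  fixes f :: "nat \<Rightarrow> real \<Rightarrow> real"
  assumes deriv: "\<And>k x. (f k has_real_derivative f (Suc k) x) (at x)"
    and bound: "\<And>x. \<bar>x - u\<bar> \<le> \<bar>h\<bar> \<Longrightarrow> \<bar>f (Suc n) x\<bar> \<le> D"
  shows "\<bar>f 0 (u + h) - (\<Sum>j\<le>n. f j u * h ^ j / fact j)\<bar> \<le> D * \<bar>h\<bar> ^ Suc n"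
proof -
  have "D \<ge> 0" using bound[of u] by auto
  have "norm (f 0 (u + h) - (\<Sum>j\<le>n. f j u * (u + h - u) ^ j / fact j))
      \<le> D * norm (u + h - u) ^ Suc n / fact n"
    by (intro field_Taylor[where S = "{u - \<bar>h\<bar>..u + \<bar>h\<bar>}"])
       (auto intro!: has_field_derivative_at_within deriv bound)
  also have "\<dots> \<le> D * norm (u + h - u) ^ Suc n / 1"
    using \<open>D \<ge> 0\<close> by (intro divide_left_mono) auto
  finally show ?thesis by simp
qed

text \<open>Taylor's theorem says that multiplication by \<open>e\<^bsup>hX\<^esup>\<close> is translation by \<open>h\<close>.\<close>

lemma fps_diff_op_translate:
  assumes deriv: "\<And>k x. (f k has_real_derivative f (Suc k) x) (at x)"
    and bound: "\<And>x. \<bar>x - u\<bar> \<le> \<bar>h\<bar> \<Longrightarrow> \<bar>f (Suc K) x\<bar> \<le> D"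
  shows "norm (fps_diff_op K b f (u + h) - fps_diff_op K (b * fps_exp (of_real h)) f u)
    \<le> (\<Sum>k\<le>K. norm (fps_nth b k) * \<bar>h\<bar> ^ Suc (K - k)) * D"
proof -
  define R where "R = (\<lambda>k. f k (u + h) - (\<Sum>j\<le>K-k. f (k + j) u * h ^ j / fact j))"
  have R: "\<bar>R k\<bar> \<le> D * \<bar>h\<bar> ^ Suc (K - k)" if "k \<le> K" for k
    using taylor_remainder_bound[of "\<lambda>j. f (k + j)" u h "K - k" D] deriv bound that
    by (simp add: R_def)
  have "fps_diff_op K b f (u + h) - fps_diff_op K (b * fps_exp (of_real h)) f u
      = (\<Sum>k\<le>K. fps_nth b k * of_real (R k))"
    unfolding fps_diff_op_mult_exp unfolding fps_diff_op_def R_def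
    by (simp add: sum_subtractf algebra_simps)
  also have "norm \<dots> \<le> (\<Sum>k\<le>K. norm (fps_nth b k) * (D * \<bar>h\<bar> ^ Suc (K - k)))"
    by (intro sum_norm_le) (auto simp: norm_mult intro!: mult_left_mono R simp del: power_Suc)
  finally show ?thesis by (simp add: sum_distrib_left mult_ac)
qed

definition euler_maclaurin_const :: "complex \<Rightarrow> real \<Rightarrow> nat \<Rightarrow> real" where
  "euler_maclaurin_const w a K = \<bar>a\<bar> ^ K
      + (\<Sum>k\<le>K. norm (fps_nth (apostol_bernoulli_fps w (of_real a)) k))"

lemma apostol_bernoulli_antidifference:
  fixes w :: complex and a :: real and K :: nat
  defines "\<beta> \<equiv> apostol_bernoulli_fps w (of_real a)"
  assumes w: "norm w \<le> 1" and K: "K \<ge> 1"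
    and deriv: "\<And>k x. (f k has_real_derivative f (Suc k) x) (at x)"
    and bound: "\<And>x. \<bar>x - u\<bar> \<le> \<bar>a\<bar> + 1 \<Longrightarrow> \<bar>f (Suc K) x\<bar> \<le> D"
  shows "norm (of_real (f 1 (u + a)) - (w * fps_diff_op K \<beta> f (u + 1) - fps_diff_op K \<beta> f u))
    \<le> euler_maclaurin_const w a K * D"
proof -
  define E where "E = fps_diff_op K fps_X f (u + a) - fps_diff_op K (fps_X * fps_exp (of_real a)) f u"
  define E' where "E' = fps_diff_op K \<beta> f (u + 1) - fps_diff_op K (\<beta> * fps_exp (of_real 1)) f u"
  have "fps_diff_op K (fps_X * fps_exp (of_real a)) f u
      = w * fps_diff_op K (\<beta> * fps_exp 1) f u - fps_diff_op K \<beta> f u"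
    unfolding \<beta>_def apostol_bernoulli_fps_mult[of w, symmetric] fps_diff_op_def
    by (simp add: right_diff_distrib left_diff_distrib sum_subtractf sum_distrib_left mult.assoc
        mult.left_commute[of _ "fps_const w"])
  hence "of_real (f 1 (u + a)) - (w * fps_diff_op K \<beta> f (u + 1) - fps_diff_op K \<beta> f u) = E - w * E'"
    by (simp add: E_def E'_def fps_diff_op_X[OF K] algebra_simps)
  hence "norm (of_real (f 1 (u + a)) - (w * fps_diff_op K \<beta> f (u + 1) - fps_diff_op K \<beta> f u))
      \<le> norm E + norm w * norm E'"
    by (metis norm_mult norm_triangle_ineq4)
  also have "norm E \<le> (\<Sum>k\<le>K. norm (fps_nth fps_X k :: complex) * \<bar>a\<bar> ^ Suc (K - k)) * D"
    unfolding E_def by (rule fps_diff_op_translate[OF deriv bound]) auto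
  also have "(\<Sum>k\<le>K. norm (fps_nth fps_X k :: complex) * \<bar>a\<bar> ^ Suc (K - k))
      = (\<Sum>k\<le>K. if k = 1 then \<bar>a\<bar> ^ Suc (K - k) else 0)"
    by (intro sum.cong) (auto simp del: power_Suc)
  also have "\<dots> = \<bar>a\<bar> ^ K" using K by (simp del: power_Suc)
  also have "norm w * norm E' \<le> 1 * ((\<Sum>k\<le>K. norm (fps_nth \<beta> k) * \<bar>1\<bar> ^ Suc (K - k)) * D)"
    unfolding E'_def by (intro mult_mono w fps_diff_op_translate[OF deriv bound]) auto
  finally show ?thesis by (simp add: euler_maclaurin_const_def \<beta>_def algebra_simps)
qed

lemma power_mult_telescope_sums:
  fixes w :: "'a :: real_normed_field"
  assumes w: "norm w \<le> 1" and H: "H \<longlonglongrightarrow> 0"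
  shows "(\<lambda>n. w ^ n * (w * H (Suc n) - H n)) sums (- H 0)"
proof -
  have w_pow: "norm (w ^ n) \<le> 1" for n using w by (simp add: norm_power power_le_one)
  have "(\<lambda>n. w ^ n * H n) \<longlonglongrightarrow> 0"
  proof (rule Lim_null_comparison)
    show "\<forall>\<^sub>F n in sequentially. norm (w ^ n * H n) \<le> norm (H n)"
      by (intro always_eventually allI) (simp only: norm_mult mult_left_le_one_le w_pow norm_ge_zero)
    show "(\<lambda>n. norm (H n)) \<longlonglongrightarrow> 0" using H by (rule tendsto_norm_zero)
  qed
  hence "(\<lambda>n. w ^ Suc n * H (Suc n) - w ^ n * H n) sums (0 - w ^ 0 * H 0)"
    by (rule telescope_sums)
  thus ?thesis by (simp add: algebra_simps)
qed

lemma twisted_euler_maclaurin: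
  fixes w :: complex and a :: real and K :: nat
  defines "\<beta> \<equiv> apostol_bernoulli_fps w (of_real a)"
  assumes w: "norm w \<le> 1" and K: "K \<ge> 1"
    and deriv: "\<And>k x. (f k has_real_derivative f (Suc k) x) (at x)"
    and tendsto: "\<And>k. (\<lambda>n. f k (real n)) \<longlonglongrightarrow> 0"
    and bound: "\<And>n x. \<bar>x - real n\<bar> \<le> \<bar>a\<bar> + 1 \<Longrightarrow> \<bar>f (Suc K) x\<bar> \<le> D n"
    and D: "summable D"
  shows "norm ((\<Sum>n. w ^ n * of_real (f 1 (real n + a))) + fps_diff_op K \<beta> f 0)
    \<le> euler_maclaurin_const w a K * (\<Sum>n. D n)"
proof -
  define H where "H = (\<lambda>n. fps_diff_op K \<beta> f (real n))"
  define e where "e = (\<lambda>n. of_real (f 1 (real n + a)) - (w * H (Suc n) - H n))"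
  have "norm (e n) \<le> euler_maclaurin_const w a K * D n" for n
    using apostol_bernoulli_antidifference[where f = f and u = "real n", OF w K deriv bound]
    by (simp add: e_def H_def \<beta>_def add.commute)
  hence e: "norm (w ^ n * e n) \<le> euler_maclaurin_const w a K * D n" for n
    using mult_mono[of "norm (w ^ n)" 1] w by (fastforce simp: norm_mult norm_power power_le_one)
  have summable_D: "summable (\<lambda>n. euler_maclaurin_const w a K * D n)"
    by (intro summable_mult D)
  have e_sums: "(\<lambda>n. w ^ n * e n) sums (\<Sum>n. w ^ n * e n)"
    by (intro summable_sums summable_comparison_test[OF _ summable_D]) (use e in auto)
  have "H \<longlonglongrightarrow> 0" unfolding H_def fps_diff_op_def
    by (intro tendsto_null_sum tendsto_mult_right_zero
        tendsto_of_real[OF tendsto, unfolded of_real_0])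
  from sums_add[OF e_sums power_mult_telescope_sums[OF w this]]
  have "(\<lambda>n. w ^ n * of_real (f 1 (real n + a))) sums ((\<Sum>n. w ^ n * e n) - H 0)"
    by (simp add: e_def algebra_simps)
  hence "(\<Sum>n. w ^ n * of_real (f 1 (real n + a))) + fps_diff_op K \<beta> f 0 = (\<Sum>n. w ^ n * e n)"
    by (simp add: sums_iff H_def)
  also have "norm \<dots> \<le> (\<Sum>n. euler_maclaurin_const w a K * D n)"
    using e_sums e summable_D by (intro norm_suminf_le) (auto simp: sums_iff)
  also have "\<dots> = euler_maclaurin_const w a K * (\<Sum>n. D n)"
    by (rule suminf_mult[OF D])
  finally show ?thesis .
qed

section \<open>Partial Gaussian sums in the closed unit disc\<close>

lemma power_le_fact_mult_exp:
  fixes x :: real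
  assumes "x \<ge> 0"
  shows "x ^ k \<le> fact k * exp x"
proof -
  have "x ^ k /\<^sub>R fact k \<le> (\<Sum>n. x ^ n /\<^sub>R fact n)"
    using sum_le_suminf[of "\<lambda>n. x ^ n /\<^sub>R fact n" "{k}"] assms
    by (simp add: summable_exp)
  thus ?thesis by (simp add: exp_def field_simps)
qed

lemma summable_inverse_one_plus_square: "summable (\<lambda>n. 1 / (1 + (real n)\<^sup>2))"
proof (rule summable_comparison_test_ev)
  show "\<forall>\<^sub>F n in sequentially. norm (1 / (1 + (real n)\<^sup>2)) \<le> inverse (real n ^ 2)"
    using eventually_gt_at_top[of 0]
    by eventually_elim (auto simp: field_simps add_pos_nonneg)
  show "summable (\<lambda>n. inverse (real n ^ 2))" by (rule inverse_power_summable) auto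
qed

lemma inverse_one_plus_mult_square_le:
  fixes s x u c :: real
  assumes s: "0 < s" "s \<le> 1" and x: "\<bar>x - u\<bar> \<le> c"
  shows "1 / (1 + s * x\<^sup>2) \<le> 2 * (1 + c\<^sup>2) / (s * (1 + u\<^sup>2))"
proof -
  have "u\<^sup>2 \<le> 2 * x\<^sup>2 + 2 * (x - u)\<^sup>2"
    using zero_le_power2[of "2 * x - u"] by (simp add: power2_eq_square algebra_simps)
  also have "(x - u)\<^sup>2 \<le> c\<^sup>2" using x by (intro abs_le_square_iff[THEN iffD1]) auto
  finally have "s * (1 + u\<^sup>2) \<le> s * (1 + 2 * c\<^sup>2) + 2 * (s * x\<^sup>2)"
    using mult_left_mono[of "1 + u\<^sup>2" "1 + 2 * c\<^sup>2 + 2 * x\<^sup>2" s] s by (simp add: algebra_simps)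
  moreover have "s * (1 + 2 * c\<^sup>2) \<le> 1 * (1 + 2 * c\<^sup>2)" using s by (intro mult_right_mono) auto
  moreover have "0 \<le> 1 + 2 * c\<^sup>2 * (s * x\<^sup>2)" using s by simp
  ultimately have "s * (1 + u\<^sup>2) \<le> 2 * (1 + c\<^sup>2) * (1 + s * x\<^sup>2)"
    by (simp only: distrib_left distrib_right mult_1_left mult_1_right)
  moreover have "0 < s * (1 + u\<^sup>2)" "0 < 1 + s * x\<^sup>2" using s by (simp_all add: add_pos_nonneg)
  ultimately show ?thesis
    using mult_imp_le_div_pos[of "s * (1 + u\<^sup>2)" "1 / (1 + s * x\<^sup>2)" "2 * (1 + c\<^sup>2)"]
    by (simp add: pos_divide_le_eq)
qed

text \<open>The additive constant makes the primitive vanish at \<open>\<infinity>\<close>.\<close>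

definition gauss_primitive :: "real \<Rightarrow> real \<Rightarrow> real" where
  "gauss_primitive s x = (LBINT u=0..x. exp (- s * u\<^sup>2)) - sqrt (pi / s) / 2"

lemma gauss_primitive_0: "gauss_primitive s 0 = - sqrt (pi / s) / 2"
  by (simp add: gauss_primitive_def flip: zero_ereal_def)

lemma gauss_primitive_has_real_derivative:
  "(gauss_primitive s has_real_derivative exp (- s * x\<^sup>2)) (at x)"
proof -
  have "((\<lambda>x. LBINT u=(0::real)..x. exp (- s * u\<^sup>2)) has_vector_derivative exp (- s * x\<^sup>2))
      (at x within {- \<bar>x\<bar> - 1..\<bar>x\<bar> + 1})"
    by (intro interval_integral_FTC2 continuous_intros) auto
  moreover have "at x within {- \<bar>x\<bar> - 1..\<bar>x\<bar> + 1} = at x"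
    by (intro at_within_Icc_at) auto
  ultimately have "((\<lambda>x. LBINT u=0..x. exp (- s * u\<^sup>2)) has_real_derivative exp (- s * x\<^sup>2)) (at x)"
    by (simp add: has_real_derivative_iff_has_vector_derivative flip: zero_ereal_def)
  thus ?thesis unfolding gauss_primitive_def by (auto intro!: derivative_eq_intros)
qed

lemma has_bochner_integral_half_gaussian:
  assumes "s > 0"
  shows "has_bochner_integral lborel (\<lambda>x::real. indicator {0..} x *\<^sub>R exp (- s * x\<^sup>2))
    (sqrt (pi / s) / 2)"
proof -
  have "has_bochner_integral lborel
      (\<lambda>x::real. indicator {0..} (0 + sqrt s * x) *\<^sub>R exp (- (0 + sqrt s * x)\<^sup>2))
      ((sqrt pi / 2) /\<^sub>R \<bar>sqrt s\<bar>)"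
    by (rule lborel_has_bochner_integral_real_affine_iff[THEN iffD1, OF _ gaussian_moment_0])
       (use assms in simp)
  also have "(\<lambda>x::real. indicator {0..} (0 + sqrt s * x) *\<^sub>R exp (- (0 + sqrt s * x)\<^sup>2))
      = (\<lambda>x. indicator {0..} x *\<^sub>R exp (- s * x\<^sup>2))"
    using assms by (intro ext) (simp add: indicator_def power_mult_distrib zero_le_mult_iff)
  also have "(sqrt pi / 2) /\<^sub>R \<bar>sqrt s\<bar> = sqrt (pi / s) / 2"
    using assms by (simp add: real_sqrt_divide field_simps)
  finally show ?thesis .
qed

lemma gauss_primitive_tendsto_0:
  assumes "s > 0"
  shows "(gauss_primitive s \<longlongrightarrow> 0) at_top"
proof -
  let ?f = "\<lambda>x::real. indicator {0..} x *\<^sub>R exp (- s * x\<^sup>2)"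
  have "((\<lambda>y. \<integral> x. indicator {..y} x *\<^sub>R ?f x \<partial>lborel) \<longlongrightarrow> (\<integral> x. ?f x \<partial>lborel)) at_top"
    using has_bochner_integral_half_gaussian[OF assms]
    by (intro tendsto_integral_at_top) (auto simp: has_bochner_integral_iff)
  moreover have "\<forall>\<^sub>F y in at_top. (\<integral> x. indicator {..y} x *\<^sub>R ?f x \<partial>lborel)
      = (LBINT u=0..y. exp (- s * u\<^sup>2))"
    using eventually_ge_at_top[of 0]
  proof eventually_elim
    case (elim y)
    have "(LBINT u=0..y. exp (- s * u\<^sup>2)) = (LINT u:{0..y}|lborel. exp (- s * u\<^sup>2))"
      using interval_integral_Icc[OF elim] by (simp flip: zero_ereal_def)
    also have "\<dots> = (\<integral> x. indicator {..y} x *\<^sub>R ?f x \<partial>lborel)"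
      unfolding set_lebesgue_integral_def
      by (intro Bochner_Integration.integral_cong) (auto simp: indicator_def)
    finally show ?case ..
  qed
  ultimately have "((\<lambda>y::real. LBINT u=0..y. exp (- s * u\<^sup>2)) \<longlongrightarrow> (\<integral> x. ?f x \<partial>lborel)) at_top"
    by (rule Lim_transform_eventually)
  hence "((\<lambda>y::real. LBINT u=0..y. exp (- s * u\<^sup>2)) \<longlongrightarrow> sqrt (pi / s) / 2) at_top"
    using has_bochner_integral_half_gaussian[OF assms] by (simp only: has_bochner_integral_iff)
  from tendsto_diff[OF this tendsto_const[of "sqrt (pi / s) / 2"]]
  show ?thesis by (simp add: gauss_primitive_def[abs_def])
qed

text \<open>\<open>gauss_deriv s k\<close> is the derivative of order \<open>k - 1\<close> of the Gaussian, so that the index is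
  the power of \<open>X\<close> in Euler--Maclaurin summation.\<close>

fun gauss_deriv :: "real \<Rightarrow> nat \<Rightarrow> real \<Rightarrow> real" where
  "gauss_deriv s 0 x = gauss_primitive s x"
| "gauss_deriv s (Suc 0) x = exp (- s * x\<^sup>2)"
| "gauss_deriv s (Suc (Suc m)) x =
     - 2 * s * (x * gauss_deriv s (Suc m) x + real m * gauss_deriv s m x)"

declare gauss_deriv.simps(3) [simp del]

lemma gauss_deriv_has_real_derivative:
  "(gauss_deriv s k has_real_derivative gauss_deriv s (Suc k) x) (at x)"
proof (induction k arbitrary: x rule: induct_nat_012)
  case 0
  have "gauss_deriv s 0 = gauss_primitive s" by auto
  thus ?case using gauss_primitive_has_real_derivative[of s x] by simp
next
  case 1
  have "gauss_deriv s (Suc 0) = (\<lambda>x. exp (- s * x\<^sup>2))" by auto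
  thus ?case by (auto intro!: derivative_eq_intros simp: gauss_deriv.simps(3))
next
  case (ge2 m)
  have "gauss_deriv s (Suc (Suc m)) =
      (\<lambda>x. - 2 * s * (x * gauss_deriv s (Suc m) x + real m * gauss_deriv s m x))"
    by (auto simp: gauss_deriv.simps(3))
  thus ?case by (auto intro!: derivative_eq_intros ge2 simp: gauss_deriv.simps(3)[of s "Suc m"]
      algebra_simps)
qed

lemma gauss_deriv_even_at_0: "gauss_deriv s (2 * k + 2) 0 = 0"
  by (induction k) (auto simp: gauss_deriv.simps(3))

lemma gauss_deriv_odd_at_0: "gauss_deriv s (2 * k + 1) 0 = (- s) ^ k * fact (2 * k) / fact k"
proof (induction k)
  case (Suc k)
  have "gauss_deriv s (2 * Suc k + 1) 0
      = - 2 * s * real (2 * k + 1) * ((- s) ^ k * fact (2 * k) / fact k)"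
    unfolding Suc[symmetric] by (simp add: gauss_deriv.simps(3))
  also have "\<dots> = (- s) ^ Suc k * (2 * (real k + 1) * (2 * real k + 1) * fact (2 * k))
      / ((real k + 1) * fact k)"
    by (simp add: divide_simps) (simp add: algebra_simps)
  also have "\<dots> = (- s) ^ Suc k * fact (2 * Suc k) / fact (Suc k)"
    by (simp add: algebra_simps)
  finally show ?case .
qed auto

lemma gauss_deriv_scale:
  "gauss_deriv (r\<^sup>2) (Suc m) x = r ^ m * gauss_deriv 1 (Suc m) (r * x)"
proof (induction m rule: induct_nat_012)
  case (ge2 m)
  show ?case unfolding gauss_deriv.simps(3)[of _ "Suc m"] ge2
    by (simp add: power2_eq_square algebra_simps)
qed (simp_all add: gauss_deriv.simps(3) power_mult_distrib power2_eq_square)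

lemma abs_power_mult_gaussian_le: "\<bar>x ^ k * exp (- x\<^sup>2)\<bar> \<le> fact k * exp 1" for x :: real
proof -
  have "0 \<le> (\<bar>x\<bar> - 1)\<^sup>2 + x\<^sup>2 + 1" by simp
  hence x: "\<bar>x\<bar> - x\<^sup>2 \<le> 1" by (simp add: power2_diff)
  have "\<bar>x ^ k * exp (- x\<^sup>2)\<bar> = \<bar>x\<bar> ^ k * exp (- x\<^sup>2)" by (simp add: abs_mult power_abs)
  also have "\<dots> \<le> (fact k * exp \<bar>x\<bar>) * exp (- x\<^sup>2)"
    by (intro mult_right_mono power_le_fact_mult_exp) auto
  also have "\<dots> = fact k * exp (\<bar>x\<bar> - x\<^sup>2)" by (simp add: exp_diff exp_minus divide_inverse)
  also have "\<dots> \<le> fact k * exp 1" using x by simp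
  finally show ?thesis .
qed

lemma power_mult_gauss_deriv_bounded: "\<exists>C. \<forall>x. \<bar>x ^ k * gauss_deriv 1 (Suc m) x\<bar> \<le> C"
proof (induction m arbitrary: k rule: induct_nat_012)
  case 0
  show ?case using abs_power_mult_gaussian_le[of _ k] by (intro exI[of _ "fact k * exp 1"]) simp
next
  case 1
  have "\<bar>x ^ k * gauss_deriv 1 (Suc (Suc 0)) x\<bar> \<le> 2 * (fact (Suc k) * exp 1)" for x
    using mult_left_mono[OF abs_power_mult_gaussian_le[of x "Suc k"], of 2]
    by (simp add: gauss_deriv.simps(3) abs_mult mult_ac)
  thus ?case by blast
next
  case (ge2 m)
  obtain A where A: "\<And>x. \<bar>x ^ Suc k * gauss_deriv 1 (Suc (Suc m)) x\<bar> \<le> A" using ge2(2) by blast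
  obtain B where B: "\<And>x. \<bar>x ^ k * gauss_deriv 1 (Suc m) x\<bar> \<le> B" using ge2(1) by blast
  have "\<bar>x ^ k * gauss_deriv 1 (Suc (Suc (Suc m))) x\<bar> \<le> 2 * A + 2 * (real (Suc m) * B)" for x
  proof -
    have "x ^ k * gauss_deriv 1 (Suc (Suc (Suc m))) x
        = - 2 * (x ^ Suc k * gauss_deriv 1 (Suc (Suc m)) x)
          - 2 * (real (Suc m) * (x ^ k * gauss_deriv 1 (Suc m) x))"
      unfolding gauss_deriv.simps(3)[of _ "Suc m"] by (simp add: algebra_simps)
    moreover have "\<bar>real (Suc m) * (x ^ k * gauss_deriv 1 (Suc m) x)\<bar> \<le> real (Suc m) * B"
      unfolding abs_mult[of "real (Suc m)"] abs_of_nat by (intro mult_left_mono B) auto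
    ultimately show ?thesis using A[of x] by linarith
  qed
  thus ?case by blast
qed

lemma gauss_deriv_decay:
  obtains C where "C \<ge> 0" "\<And>s x. s > 0 \<Longrightarrow> \<bar>gauss_deriv s (Suc m) x\<bar> \<le> C * sqrt s ^ m / (1 + s * x\<^sup>2)"
proof -
  obtain A where A: "\<And>x. \<bar>x ^ 0 * gauss_deriv 1 (Suc m) x\<bar> \<le> A"
    using power_mult_gauss_deriv_bounded by blast
  obtain B where B: "\<And>x. \<bar>x ^ 2 * gauss_deriv 1 (Suc m) x\<bar> \<le> B"
    using power_mult_gauss_deriv_bounded by blast
  have unscaled: "\<bar>gauss_deriv 1 (Suc m) y\<bar> \<le> (A + B) / (1 + y\<^sup>2)" for y
  proof -
    have "\<bar>gauss_deriv 1 (Suc m) y\<bar> * (1 + y\<^sup>2) \<le> A + B"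
      using add_mono[OF A[of y] B[of y]] by (simp add: abs_mult distrib_left mult.commute)
    thus ?thesis by (subst pos_le_divide_eq) (auto simp: add_pos_nonneg)
  qed
  show ?thesis
  proof (rule that)
    show "A + B \<ge> 0" using A[of 0] B[of 0] by linarith
    fix s x :: real assume s: "s > 0"
    hence "\<bar>gauss_deriv s (Suc m) x\<bar> = sqrt s ^ m * \<bar>gauss_deriv 1 (Suc m) (sqrt s * x)\<bar>"
      using gauss_deriv_scale[of "sqrt s" m x] by (simp add: abs_mult)
    also have "\<dots> \<le> sqrt s ^ m * ((A + B) / (1 + (sqrt s * x)\<^sup>2))"
      using s by (intro mult_left_mono unscaled) auto
    finally show "\<bar>gauss_deriv s (Suc m) x\<bar> \<le> (A + B) * sqrt s ^ m / (1 + s * x\<^sup>2)"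
      using s by (simp add: power_mult_distrib mult_ac)
  qed
qed

lemma gauss_deriv_tendsto_0:
  assumes s: "s > 0"
  shows "(\<lambda>n. gauss_deriv s k (real n)) \<longlonglongrightarrow> 0"
proof (cases k)
  case 0
  thus ?thesis
    using filterlim_compose[OF gauss_primitive_tendsto_0[OF s] filterlim_real_sequentially] by simp
next
  case (Suc m)
  obtain C where C: "\<And>s x. s > 0 \<Longrightarrow> \<bar>gauss_deriv s (Suc m) x\<bar> \<le> C * sqrt s ^ m / (1 + s * x\<^sup>2)"
    using gauss_deriv_decay by blast
  have "\<forall>\<^sub>F n in sequentially. norm (gauss_deriv s k (real n))
      \<le> C * sqrt s ^ m / (1 + s * (real n)\<^sup>2)"
    unfolding Suc by (intro always_eventually allI) (use C[OF s] in simp)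
  moreover have "(\<lambda>n. B / (1 + s * (real n)\<^sup>2)) \<longlonglongrightarrow> 0" for B using s by real_asymp
  ultimately show ?thesis by (rule Lim_null_comparison)
qed

definition shifted_gauss_sum :: "complex \<Rightarrow> real \<Rightarrow> real \<Rightarrow> complex" where
  "shifted_gauss_sum w a s = (\<Sum>n. w ^ n * of_real (exp (- s * (real n + a)\<^sup>2)))"

definition gauss_sum_expansion :: "complex \<Rightarrow> real \<Rightarrow> nat \<Rightarrow> real \<Rightarrow> complex" where
  "gauss_sum_expansion w a N s = fps_nth (apostol_bernoulli_fps w (of_real a)) 0
      * of_real (sqrt (pi / s) / 2)
     - (\<Sum>k\<le>N. fps_nth (apostol_bernoulli_fps w (of_real a)) (2 * k + 1)
              * of_real ((- s) ^ k * fact (2 * k) / fact k))"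

lemma fps_diff_op_gauss_deriv_at_0:
  "fps_diff_op (2 * N + 2) (apostol_bernoulli_fps w (of_real a)) (gauss_deriv s) 0
      = - gauss_sum_expansion w a N s"
proof (induction N)
  case 0
  show ?case using gauss_deriv_even_at_0[of s 0]
    by (simp add: fps_diff_op_def gauss_sum_expansion_def numeral_2_eq_2 gauss_primitive_0)
next
  case (Suc N)
  have step: "fps_diff_op (2 * Suc N + 2) b f 0 = fps_diff_op (2 * N + 2) b f 0
      + fps_nth b (2 * Suc N + 1) * of_real (f (2 * Suc N + 1) 0)
      + fps_nth b (2 * Suc N + 2) * of_real (f (2 * Suc N + 2) 0)" for b f
    by (simp add: fps_diff_op_def)
  show ?case
    unfolding step Suc gauss_deriv_odd_at_0 gauss_deriv_even_at_0
    unfolding gauss_sum_expansion_def by (simp del: fact_Suc power_Suc)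
qed

lemma bigo_at_right_0_powerI:
  fixes f :: "real \<Rightarrow> complex"
  assumes "\<And>s. 0 < s \<Longrightarrow> s \<le> 1 \<Longrightarrow> norm (f s) \<le> C * s ^ n"
  shows "f \<in> O[at_right 0](\<lambda>s. of_real s ^ n)"
proof (rule bigoI)
  have "eventually (\<lambda>s. s \<in> {0<..<1}) (at_right (0::real))" by (rule eventually_at_right_real) simp
  thus "\<forall>\<^sub>F s in at_right 0. norm (f s) \<le> C * norm (complex_of_real s ^ n)"
    by eventually_elim (use assms in \<open>simp add: norm_power\<close>)
qed

lemma shifted_gauss_sum_euler_maclaurin:
  assumes w: "norm w \<le> 1"
  obtains C where "\<And>s. 0 < s \<Longrightarrow> s \<le> 1 \<Longrightarrow>
    norm (shifted_gauss_sum w a s - gauss_sum_expansion w a (N + 1) s) \<le> C * s ^ (N + 1)"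
proof -
  define K where "K = 2 * (N + 1) + 2"
  obtain C where C: "C \<ge> 0" "\<And>s x. s > 0 \<Longrightarrow> \<bar>gauss_deriv s (Suc K) x\<bar> \<le> C * sqrt s ^ K / (1 + s * x\<^sup>2)"
    using gauss_deriv_decay by blast
  define c where "c = C * (2 * (1 + (\<bar>a\<bar> + 1)\<^sup>2))"
  show ?thesis
  proof (rule that)
    fix s :: real assume s: "0 < s" "s \<le> 1"
    define D where "D = (\<lambda>n. c * s ^ (N + 1) * (1 / (1 + (real n)\<^sup>2)))"
    have pow: "sqrt s ^ K = s * s ^ (N + 1)"
    proof -
      have "sqrt s ^ K = ((sqrt s)\<^sup>2) ^ (N + 2)" unfolding K_def power_mult[symmetric] by simp
      thus ?thesis using s by simp
    qed
    have bound: "\<bar>gauss_deriv s (Suc K) x\<bar> \<le> D n" if "\<bar>x - real n\<bar> \<le> \<bar>a\<bar> + 1" for n x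
    proof -
      have "\<bar>gauss_deriv s (Suc K) x\<bar> \<le> C * sqrt s ^ K * (1 / (1 + s * x\<^sup>2))"
        using C(2)[OF s(1)] by simp
      also have "\<dots> \<le> C * sqrt s ^ K * (2 * (1 + (\<bar>a\<bar> + 1)\<^sup>2) / (s * (1 + (real n)\<^sup>2)))"
        using s C(1) by (intro mult_left_mono inverse_one_plus_mult_square_le that) auto
      also have "\<dots> = D n" using s by (simp add: D_def c_def pow)
      finally show ?thesis .
    qed
    have D: "summable D" unfolding D_def by (intro summable_mult summable_inverse_one_plus_square)
    have "norm ((\<Sum>n. w ^ n * of_real (gauss_deriv s 1 (real n + a)))
        + fps_diff_op K (apostol_bernoulli_fps w (of_real a)) (gauss_deriv s) 0)
        \<le> euler_maclaurin_const w a K * (\<Sum>n. D n)"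
      by (rule twisted_euler_maclaurin[OF w _
            gauss_deriv_has_real_derivative gauss_deriv_tendsto_0 bound D])
         (use s in \<open>auto simp: K_def\<close>)
    thus "norm (shifted_gauss_sum w a s - gauss_sum_expansion w a (N + 1) s)
        \<le> euler_maclaurin_const w a K * (c * (\<Sum>n. 1 / (1 + (real n)\<^sup>2))) * s ^ (N + 1)"
      unfolding K_def fps_diff_op_gauss_deriv_at_0 D_def
        suminf_mult[OF summable_inverse_one_plus_square]
      by (simp add: shifted_gauss_sum_def mult_ac)
  qed
qed

lemma shifted_gauss_sum_asymp_unit_disc:
  assumes "norm w \<le> 1"
  shows "(\<lambda>s. shifted_gauss_sum w a s - gauss_sum_expansion w a N s)
      \<in> O[at_right 0](\<lambda>s. of_real s ^ (N + 1))"
proof -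
  define b where "b = fps_nth (apostol_bernoulli_fps w (of_real a)) (2 * (N + 1) + 1)
    * of_real (fact (2 * (N + 1)) / fact (N + 1))"
  obtain C where C: "\<And>s. 0 < s \<Longrightarrow> s \<le> 1 \<Longrightarrow>
      norm (shifted_gauss_sum w a s - gauss_sum_expansion w a (N + 1) s) \<le> C * s ^ (N + 1)"
    using shifted_gauss_sum_euler_maclaurin[OF assms] by blast
  have "shifted_gauss_sum w a s - gauss_sum_expansion w a N s
      = (shifted_gauss_sum w a s - gauss_sum_expansion w a (N + 1) s)
        - b * of_real ((- s) ^ (N + 1))" for s
    by (simp add: gauss_sum_expansion_def b_def del: fact_Suc power_Suc)
  hence one_more_term: "norm (shifted_gauss_sum w a s - gauss_sum_expansion w a N s)
      \<le> norm (shifted_gauss_sum w a s - gauss_sum_expansion w a (N + 1) s)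
        + norm (b * of_real ((- s) ^ (N + 1)))" for s
    by (metis norm_triangle_ineq4)
  have "norm (shifted_gauss_sum w a s - gauss_sum_expansion w a N s) \<le> (C + norm b) * s ^ (N + 1)"
    if "0 < s" "s \<le> 1" for s
    using C[OF that] that one_more_term[of s]
    by (auto simp: norm_mult norm_power distrib_right simp del: power_Suc)
  thus ?thesis by (rule bigo_at_right_0_powerI)
qed

section \<open>Poisson summation\<close>

lemma has_sum_int:
  fixes f :: "int \<Rightarrow> 'a :: topological_comm_monoid_add"
  assumes "((\<lambda>n. f (int n)) has_sum A) UNIV" and "((\<lambda>n. f (- int (Suc n))) has_sum B) UNIV"
  shows "(f has_sum (A + B)) UNIV"
proof -
  have "(f has_sum A) (range int)"
    using assms(1) has_sum_reindex[of int UNIV f A] by (simp add: o_def)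
  moreover have "(f has_sum B) (range (\<lambda>n. - int (Suc n)))"
    using assms(2) has_sum_reindex[of "\<lambda>n. - int (Suc n)" UNIV f B] by (simp add: o_def inj_on_def)
  moreover have "range int \<inter> range (\<lambda>n. - int (Suc n)) = {}" by auto
  ultimately have "(f has_sum (A + B)) (range int \<union> range (\<lambda>n. - int (Suc n)))"
    by (rule has_sum_Un_disjoint)
  also have "range int \<union> range (\<lambda>n. - int (Suc n)) = UNIV"
    by (metis (no_types, lifting) UNIV_eq_I UnCI int_cases rangeI)
  finally show ?thesis .
qed

lemma summable_on_int_abs:
  fixes g :: "nat \<Rightarrow> real"
  assumes g: "summable g" "\<And>n. g n \<ge> 0"
  shows "(\<lambda>m::int. g (nat \<bar>m\<bar>)) summable_on UNIV"
proof -
  have "summable (\<lambda>n. g (Suc n))" using g by (simp add: summable_Suc_iff)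
  hence "(g has_sum (\<Sum>n. g n)) UNIV" "((\<lambda>n. g (Suc n)) has_sum (\<Sum>n. g (Suc n))) UNIV"
    using g by (auto intro!: sums_nonneg_imp_has_sum summable_sums)
  hence "((\<lambda>m::int. g (nat \<bar>m\<bar>)) has_sum ((\<Sum>n. g n) + (\<Sum>n. g (Suc n)))) UNIV"
    by (intro has_sum_int) (simp_all add: nat_add_distrib)
  thus ?thesis by (auto simp: summable_on_def)
qed

lemma has_sum_int_imp_symmetric_LIMSEQ:
  assumes "(f has_sum S) (UNIV :: int set)"
  shows "(\<lambda>R. \<Sum>n\<in>{- int R..int R}. f n) \<longlonglongrightarrow> S"
proof -
  have "filterlim (\<lambda>R. {- int R..int R}) (finite_subsets_at_top UNIV) sequentially"
    unfolding filterlim_finite_subsets_at_top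
  proof (intro allI impI)
    fix X :: "int set" assume X: "finite X \<and> X \<subseteq> UNIV"
    define M where "M = Max (insert 0 (abs ` X))"
    have M: "\<bar>n\<bar> \<le> M" if "n \<in> X" for n unfolding M_def using X that by (intro Max_ge) auto
    show "\<forall>\<^sub>F R in sequentially. finite {- int R..int R} \<and> X \<subseteq> {- int R..int R}
        \<and> {- int R..int R} \<subseteq> UNIV"
      using eventually_ge_at_top[of "nat M"]
      by eventually_elim (use M in fastforce)
  qed
  thus ?thesis using assms unfolding has_sum_def by (rule filterlim_compose[rotated])
qed

lemma sum_int_symmetric_Suc:
  fixes h :: "int \<Rightarrow> 'a :: comm_monoid_add"
  shows "(\<Sum>m\<in>{- int (Suc M)..int (Suc M)}. h m)
    = h (- int M - 1) + (h (int M + 1) + (\<Sum>m\<in>{- int M..int M}. h m))"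
proof -
  have "{- int (Suc M)..int (Suc M)} = insert (- int M - 1) (insert (int M + 1) {- int M..int M})"
    by auto
  thus ?thesis by simp
qed

lemma sum_int_symmetric_telescope:
  fixes h :: "int \<Rightarrow> 'a :: ab_group_add"
  shows "(\<Sum>m\<in>{- int M..int M}. h (m - 1) - h m) = h (- int M - 1) - h (int M)"
proof (induction M)
  case (Suc M)
  show ?case unfolding sum_int_symmetric_Suc Suc by (simp add: add.commute)
qed auto

abbreviation fourier_char :: "int \<Rightarrow> real \<Rightarrow> complex" where
  "fourier_char m x \<equiv> exp (- (2 * of_real pi * \<i> * of_int m * of_real x))"

definition fourier_coeff :: "(real \<Rightarrow> complex) \<Rightarrow> int \<Rightarrow> complex" where
  "fourier_coeff f m = integral {- 1 / 2..1 / 2} (\<lambda>x. f x * fourier_char m x)"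

lemma fourier_char_add_int: "fourier_char m (x + of_int n) = fourier_char m x"
  unfolding exp_eq by (intro exI[of _ "- m * n"]) (simp add: algebra_simps)

lemma fourier_char_has_vector_derivative:
  "((\<lambda>x. fourier_char m x) has_vector_derivative
     - (2 * of_real pi * \<i> * of_int m) * fourier_char m x) (at x within S)"
proof -
  have "((\<lambda>z. exp (- (2 * of_real pi * \<i> * of_int m * z))) has_field_derivative
      - (2 * of_real pi * \<i> * of_int m) * fourier_char m x) (at (of_real x))"
    by (auto intro!: derivative_eq_intros)
  thus ?thesis by (rule has_vector_derivative_real_field)
qed

lemma fourier_coeff_const: "fourier_coeff (\<lambda>_. c) m = (if m = 0 then c else 0)"
proof (cases "m = 0")
  case False
  define \<kappa> where "\<kappa> = - (2 * of_real pi * \<i> * complex_of_int m)"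
  have "((\<lambda>x. \<kappa> * fourier_char m x)
      has_integral (fourier_char m (1 / 2) - fourier_char m (- 1 / 2))) {- 1 / 2..1 / 2}"
    unfolding \<kappa>_def
    by (intro fundamental_theorem_of_calculus fourier_char_has_vector_derivative) auto
  moreover have "fourier_char m (1 / 2) = fourier_char m (- 1 / 2)"
    using fourier_char_add_int[of m "- 1 / 2" 1] by simp
  ultimately have "((\<lambda>x. \<kappa> * fourier_char m x) has_integral 0) {- 1 / 2..1 / 2}" by simp
  from has_integral_mult_right[OF this, of "c / \<kappa>"]
  have "((\<lambda>x. c * fourier_char m x) has_integral 0) {- 1 / 2..1 / 2}"
    using False by (simp add: \<kappa>_def)
  from integral_unique[OF this] show ?thesis using False by (simp add: fourier_coeff_def)
qed (simp add: fourier_coeff_def)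

lemma fourier_integrable:
  assumes "continuous_on {- 1 / 2..1 / 2} f"
  shows "(\<lambda>x. f x * fourier_char m x) integrable_on {- 1 / 2..1 / 2}"
  using assms by (intro integrable_continuous_interval continuous_intros)

lemma fourier_coeff_cong:
  assumes "\<And>x. x \<in> {- 1 / 2..1 / 2} \<Longrightarrow> f x = g x"
  shows "fourier_coeff f m = fourier_coeff g m"
  unfolding fourier_coeff_def using assms by (intro integral_cong) auto

lemma fourier_coeff_add:
  assumes "continuous_on {- 1 / 2..1 / 2} f" "continuous_on {- 1 / 2..1 / 2} g"
  shows "fourier_coeff (\<lambda>x. f x + g x) m = fourier_coeff f m + fourier_coeff g m"
  unfolding fourier_coeff_def distrib_right
  by (intro Henstock_Kurzweil_Integration.integral_add fourier_integrable assms)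

lemma fourier_coeff_diff:
  assumes "continuous_on {- 1 / 2..1 / 2} f" "continuous_on {- 1 / 2..1 / 2} g"
  shows "fourier_coeff (\<lambda>x. f x - g x) m = fourier_coeff f m - fourier_coeff g m"
  unfolding fourier_coeff_def left_diff_distrib
  by (intro Henstock_Kurzweil_Integration.integral_diff fourier_integrable assms)

lemma fourier_coeff_shift:
  "fourier_coeff (\<lambda>x. exp (2 * of_real pi * \<i> * of_real x) * f x) m = fourier_coeff f (m - 1)"
proof -
  have "exp (2 * of_real pi * \<i> * of_real x) * f x * fourier_char m x
      = f x * fourier_char (m - 1) x" for x
    by (simp add: mult_ac flip: exp_add) (simp add: algebra_simps)
  thus ?thesis by (simp only: fourier_coeff_def)
qed

lemma fourier_coeff_deriv:
  assumes deriv: "\<And>x. x \<in> {- 1 / 2..1 / 2}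
      \<Longrightarrow> (g has_vector_derivative g' x) (at x within {- 1 / 2..1 / 2})"
    and cont: "continuous_on {- 1 / 2..1 / 2} g'"
  shows "2 * of_real pi * \<i> * of_int m * fourier_coeff g m
    = fourier_coeff g' m - (g (1 / 2) - g (- 1 / 2)) * fourier_char m (1 / 2)"
proof -
  define \<kappa> where "\<kappa> = 2 * of_real pi * \<i> * complex_of_int m"
  have cont_g: "continuous_on {- 1 / 2..1 / 2} g"
    by (rule continuous_on_vector_derivative[OF deriv])
  have coeff: "((\<lambda>x. h x * fourier_char m x) has_integral fourier_coeff h m) {- 1 / 2..1 / 2}"
    if "continuous_on {- 1 / 2..1 / 2} h" for h
    unfolding fourier_coeff_def by (intro integrable_integral fourier_integrable that)
  have "((\<lambda>x. g' x * fourier_char m x - \<kappa> * (g x * fourier_char m x)) has_integral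
      (g (1 / 2) * fourier_char m (1 / 2) - g (- 1 / 2) * fourier_char m (- 1 / 2))) {- 1 / 2..1 / 2}"
  proof (rule fundamental_theorem_of_calculus)
    fix x :: real assume "x \<in> {- 1 / 2..1 / 2}"
    from has_vector_derivative_mult[OF deriv[OF this] fourier_char_has_vector_derivative[of m]]
    show "((\<lambda>x. g x * fourier_char m x) has_vector_derivative
        g' x * fourier_char m x - \<kappa> * (g x * fourier_char m x)) (at x within {- 1 / 2..1 / 2})"
      by (simp add: \<kappa>_def algebra_simps)
  qed simp
  moreover have "((\<lambda>x. g' x * fourier_char m x - \<kappa> * (g x * fourier_char m x)) has_integral
      (fourier_coeff g' m - \<kappa> * fourier_coeff g m)) {- 1 / 2..1 / 2}"
    by (intro has_integral_diff has_integral_mult_right coeff cont cont_g)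
  ultimately have "g (1 / 2) * fourier_char m (1 / 2) - g (- 1 / 2) * fourier_char m (- 1 / 2)
      = fourier_coeff g' m - \<kappa> * fourier_coeff g m"
    by (rule has_integral_unique)
  moreover have "fourier_char m (- 1 / 2) = fourier_char m (1 / 2)"
    using fourier_char_add_int[of m "- 1 / 2" 1] by simp
  ultimately show ?thesis unfolding \<kappa>_def[symmetric] by (simp add: algebra_simps)
qed

lemma norm_fourier_coeff_le:
  assumes "continuous_on {- 1 / 2..1 / 2} f"
  shows "norm (fourier_coeff f m) \<le> integral {- 1 / 2..1 / 2} (\<lambda>x. norm (f x))"
  unfolding fourier_coeff_def using assms
  by (intro integral_norm_bound_integral fourier_integrable integrable_continuous_interval
      continuous_intros)
     (auto simp: norm_mult)

lemma fourier_coeff_decay: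
  assumes deriv: "\<And>x. x \<in> {- 1 / 2..1 / 2}
      \<Longrightarrow> (g has_vector_derivative g' x) (at x within {- 1 / 2..1 / 2})"
    and cont: "continuous_on {- 1 / 2..1 / 2} g'"
  obtains C where "\<And>m. \<bar>real_of_int m\<bar> * norm (fourier_coeff g m) \<le> C"
proof (rule that)
  fix m
  have "\<bar>real_of_int m\<bar> * norm (fourier_coeff g m)
      \<le> 2 * pi * (\<bar>real_of_int m\<bar> * norm (fourier_coeff g m))"
    using pi_ge_two mult_right_mono[of 1 "2 * pi" "\<bar>real_of_int m\<bar> * norm (fourier_coeff g m)"]
    by simp
  also have "\<dots> = norm (2 * of_real pi * \<i> * of_int m * fourier_coeff g m)"
    by (simp add: norm_mult)
  also have "\<dots> = norm (fourier_coeff g' m - (g (1 / 2) - g (- 1 / 2)) * fourier_char m (1 / 2))"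
    by (rule arg_cong[OF fourier_coeff_deriv[OF deriv cont], of norm])
  also have "\<dots> \<le> integral {- 1 / 2..1 / 2} (\<lambda>x. norm (g' x)) + norm (g (1 / 2) - g (- 1 / 2))"
    by (rule order_trans[OF norm_triangle_ineq4])
       (use norm_fourier_coeff_le[OF cont] in \<open>auto simp: norm_mult\<close>)
  finally show "\<bar>real_of_int m\<bar> * norm (fourier_coeff g m)
      \<le> integral {- 1 / 2..1 / 2} (\<lambda>x. norm (g' x)) + norm (g (1 / 2) - g (- 1 / 2))" .
qed

lemma fourier_coeff_decay_holomorphic:
  assumes g: "g holomorphic_on S" "open S" "complex_of_real ` {- 1 / 2..1 / 2} \<subseteq> S"
  obtains C where "\<And>m. \<bar>real_of_int m\<bar> * norm (fourier_coeff (\<lambda>x. g (of_real x)) m) \<le> C"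
proof (rule fourier_coeff_decay)
  fix x :: real assume "x \<in> {- 1 / 2..1 / 2}"
  hence "(g has_field_derivative deriv g (of_real x)) (at (of_real x))"
    using g by (intro holomorphic_derivI[OF g(1,2)]) auto
  thus "((\<lambda>x. g (of_real x)) has_vector_derivative deriv g (of_real x))
      (at x within {- 1 / 2..1 / 2})"
    by (rule has_vector_derivative_real_field)
next
  have "continuous_on S (deriv g)"
    using g by (intro holomorphic_on_imp_continuous_on holomorphic_deriv)
  thus "continuous_on {- 1 / 2..1 / 2} (\<lambda>x. deriv g (complex_of_real x))"
    by (rule continuous_on_compose2) (use g in \<open>auto intro!: continuous_intros\<close>)
qed (rule that)

lemma fourier_coeff_diff_tendsto_0:
  assumes "g holomorphic_on S" "open S" "complex_of_real ` {- 1 / 2..1 / 2} \<subseteq> S"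
  defines "\<gamma> \<equiv> fourier_coeff (\<lambda>x. g (of_real x))"
  shows "(\<lambda>M. \<gamma> (- int M - 1) - \<gamma> (int M)) \<longlonglongrightarrow> 0"
proof -
  obtain C where C: "\<And>m. \<bar>real_of_int m\<bar> * norm (\<gamma> m) \<le> C"
    unfolding \<gamma>_def using fourier_coeff_decay_holomorphic[OF assms(1-3)] by blast
  have \<gamma>_le: "norm (\<gamma> m) \<le> C / real k" if "\<bar>m\<bar> \<ge> int k" "k > 0" for m k
  proof -
    have "real k * norm (\<gamma> m) \<le> \<bar>real_of_int m\<bar> * norm (\<gamma> m)"
      using that by (intro mult_right_mono) auto
    thus ?thesis using C[of m] that by (simp add: field_simps)
  qed
  have "\<forall>\<^sub>F M in sequentially. norm (\<gamma> (- int M - 1) - \<gamma> (int M)) \<le> 2 * (C / real M)"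
    using eventually_gt_at_top[of 0]
  proof eventually_elim
    case (elim M)
    thus ?case
      using \<gamma>_le[of M "- int M - 1"] \<gamma>_le[of M "int M"]
        norm_triangle_ineq4[of "\<gamma> (- int M - 1)" "\<gamma> (int M)"] by simp
  qed
  moreover have "(\<lambda>M. 2 * (C / real M)) \<longlonglongrightarrow> 0" by real_asymp
  ultimately show ?thesis by (rule Lim_null_comparison)
qed

text \<open>Chernoff's proof of Dirichlet's theorem divides \<open>f(x) - f(0)\<close> by \<open>e\<^bsup>2\<pi>ix\<^esup> - 1\<close>.\<close>

lemma chernoff_quotient_holomorphic:
  assumes f: "f holomorphic_on ball 0 1"
  obtains g where "g holomorphic_on ball 0 1"
    "\<And>z. z \<in> ball 0 1 \<Longrightarrow> f z = f 0 + (exp (2 * of_real pi * \<i> * z) - 1) * g z"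
proof -
  define E where "E = (\<lambda>z. exp (2 * of_real pi * \<i> * z))"
  define slope where "slope = (\<lambda>h z.
    if z = 0 then deriv h 0 else (h z - h 0) / (z - 0 :: complex) :: complex)"
  have E: "E holomorphic_on ball 0 1" unfolding E_def by (intro holomorphic_intros)
  have "(E has_field_derivative 2 * of_real pi * \<i>) (at 0)"
    unfolding E_def by (auto intro!: derivative_eq_intros)
  hence deriv_E: "deriv E 0 = 2 * of_real pi * \<i>" by (rule DERIV_imp_deriv)
  have E_neq_1: "E z \<noteq> 1" if "z \<in> ball 0 1" "z \<noteq> 0" for z
  proof
    assume "E z = 1"
    then obtain n where "Im (2 * of_real pi * \<i> * z) = of_int (2 * n) * pi"
        "Re (2 * of_real pi * \<i> * z) = 0"
      unfolding E_def exp_eq_1 by auto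
    hence "z = of_int n" by (simp add: complex_eq_iff)
    thus False using that by auto
  qed
  have slope_E: "slope E z \<noteq> 0" if "z \<in> ball 0 1" for z
    using E_neq_1[OF that] deriv_E by (auto simp: slope_def E_def)
  show ?thesis
  proof (rule that)
    show "(\<lambda>z. slope f z / slope E z) holomorphic_on ball 0 1"
      using slope_E unfolding slope_def by (intro holomorphic_on_divide pole_lemma f E) auto
    fix z :: complex assume "z \<in> ball 0 1"
    thus "f z = f 0 + (exp (2 * of_real pi * \<i> * z) - 1) * (slope f z / slope E z)"
      using slope_E[of z] E_neq_1[of z] by (auto simp: slope_def E_def)
  qed
qed

lemma fourier_series_at_0:
  assumes f: "f holomorphic_on ball 0 1"
  shows "(\<lambda>M. \<Sum>m\<in>{- int M..int M}. fourier_coeff (\<lambda>x. f (of_real x)) m) \<longlonglongrightarrow> f 0"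
proof -
  obtain g where g: "g holomorphic_on ball 0 1"
    and fg: "\<And>z. z \<in> ball 0 1 \<Longrightarrow> f z = f 0 + (exp (2 * of_real pi * \<i> * z) - 1) * g z"
    using chernoff_quotient_holomorphic[OF f] by blast
  define \<gamma> where "\<gamma> = fourier_coeff (\<lambda>x. g (of_real x))"
  have sub: "complex_of_real ` {- 1 / 2..1 / 2} \<subseteq> ball 0 1" by (auto simp: dist_norm)
  have cont: "continuous_on {- 1 / 2..1 / 2} (\<lambda>x. g (complex_of_real x))"
    by (intro continuous_on_compose2[OF holomorphic_on_imp_continuous_on[OF g] _ sub]
        continuous_intros)
  have "fourier_coeff (\<lambda>x. f (of_real x)) m = (if m = 0 then f 0 else 0) + (\<gamma> (m - 1) - \<gamma> m)" for m
  proof -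
    have "fourier_coeff (\<lambda>x. f (of_real x)) m
        = fourier_coeff (\<lambda>x. f 0
            + (exp (2 * of_real pi * \<i> * of_real x) * g (of_real x) - g (of_real x))) m"
      by (rule fourier_coeff_cong, subst fg) (use sub in \<open>auto simp: left_diff_distrib\<close>)
    also have "\<dots> = fourier_coeff (\<lambda>_. f 0) m
        + (fourier_coeff (\<lambda>x. exp (2 * of_real pi * \<i> * of_real x) * g (of_real x)) m - \<gamma> m)"
      unfolding \<gamma>_def
      by (subst fourier_coeff_add, (intro continuous_intros cont)+)
         (subst fourier_coeff_diff, (intro continuous_intros cont)+, rule refl)
    also have "\<dots> = (if m = 0 then f 0 else 0) + (\<gamma> (m - 1) - \<gamma> m)"
      unfolding fourier_coeff_const fourier_coeff_shift \<gamma>_def ..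
    finally show ?thesis .
  qed
  hence "(\<Sum>m\<in>{- int M..int M}. fourier_coeff (\<lambda>x. f (of_real x)) m)
      = f 0 + (\<gamma> (- int M - 1) - \<gamma> (int M))" for M
    by (simp add: sum.distrib sum_int_symmetric_telescope)
  thus ?thesis
    using tendsto_add[OF tendsto_const[of "f 0"] fourier_coeff_diff_tendsto_0[OF g open_ball sub]]
    by (simp add: \<gamma>_def)
qed

lemma integral_symmetric_unit_intervals:
  fixes \<psi> :: "real \<Rightarrow> complex"
  assumes \<psi>: "continuous_on UNIV \<psi>"
  shows "(\<Sum>n\<in>{- int R..int R}. integral {- 1 / 2..1 / 2} (\<lambda>x. \<psi> (x + of_int n)))
    = integral {- real R - 1 / 2..real R + 1 / 2} \<psi>"
proof -
  have shift: "integral {- 1 / 2..1 / 2} (\<lambda>x. \<psi> (x + y)) = integral {y - 1 / 2..y + 1 / 2} \<psi>" for y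
    using integral_shift_real_ivl[of "y - 1 / 2" y "y + 1 / 2" \<psi>] by simp
  have combine: "integral {u..v} \<psi> + integral {v..w} \<psi> = integral {u..w} \<psi>"
    if "u \<le> v" "v \<le> w" for u v w
    using that
    by (intro Henstock_Kurzweil_Integration.integral_combine integrable_continuous_interval
        continuous_on_subset[OF \<psi>]) auto
  show ?thesis
  proof (induction R)
    case 0
    show ?case using shift[of 0] by simp
  next
    case (Suc R)
    define r where "r = real R + 1 / 2"
    have "r \<ge> 0" by (simp add: r_def)
    define I where "I = (\<lambda>n::int. integral {- 1 / 2..1 / 2} (\<lambda>x. \<psi> (x + of_int n)))"
    have ends: "real_of_int (- int R - 1) - 1 / 2 = - r - 1" "real_of_int (- int R - 1) + 1 / 2 = - r"
      "real_of_int (int R + 1) - 1 / 2 = r" "real_of_int (int R + 1) + 1 / 2 = r + 1"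
      by (simp_all add: r_def)
    have "sum I {- int (Suc R)..int (Suc R)}
        = integral {- r - 1..- r} \<psi> + (integral {r..r + 1} \<psi> + integral {- r..r} \<psi>)"
      using Suc by (simp only: sum_int_symmetric_Suc I_def shift ends) (simp add: r_def)
    also have "\<dots> = (integral {- r - 1..- r} \<psi> + integral {- r..r} \<psi>) + integral {r..r + 1} \<psi>"
      by (simp only: add_ac)
    also have "\<dots> = integral {- r - 1..r + 1} \<psi>" using \<open>r \<ge> 0\<close> by (simp add: combine)
    also have "{- r - 1..r + 1} = {- real (Suc R) - 1 / 2..real (Suc R) + 1 / 2}"
      by (simp add: r_def)
    finally show ?case unfolding I_def .
  qed
qed

lemma integral_symmetric_tendsto_lborel:
  fixes \<psi> :: "real \<Rightarrow> complex"
  assumes \<psi>: "continuous_on UNIV \<psi>" and I: "has_bochner_integral lborel \<psi> I"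
  shows "(\<lambda>R. integral {- real R - 1 / 2..real R + 1 / 2} \<psi>) \<longlonglongrightarrow> I"
proof -
  have [measurable]: "\<psi> \<in> borel_measurable lborel"
    using borel_measurable_continuous_onI[OF \<psi>] by simp
  have "(\<lambda>R. \<integral>x. indicator {- real R - 1 / 2..real R + 1 / 2} x *\<^sub>R \<psi> x \<partial>lborel) \<longlonglongrightarrow> (\<integral>x. \<psi> x \<partial>lborel)"
  proof (rule integral_dominated_convergence[where w = "\<lambda>x. norm (\<psi> x)"])
    show "integrable lborel (\<lambda>x. norm (\<psi> x))" using I by (simp add: has_bochner_integral_iff)
    show "AE x in lborel. (\<lambda>R. indicator {- real R - 1 / 2..real R + 1 / 2} x *\<^sub>R \<psi> x) \<longlonglongrightarrow> \<psi> x"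
    proof (rule AE_I2)
      fix x :: real
      obtain R0 :: nat where "\<bar>x\<bar> \<le> real R0" using real_arch_simple by blast
      thus "(\<lambda>R. indicator {- real R - 1 / 2..real R + 1 / 2} x *\<^sub>R \<psi> x) \<longlonglongrightarrow> \<psi> x"
        by (intro tendsto_eventually eventually_mono[OF eventually_ge_at_top[of R0]])
           (auto simp: indicator_def)
    qed
  qed (auto simp: indicator_def)
  moreover have "(\<integral>x. indicator {- real R - 1 / 2..real R + 1 / 2} x *\<^sub>R \<psi> x \<partial>lborel)
      = integral {- real R - 1 / 2..real R + 1 / 2} \<psi>" for R
    unfolding set_lebesgue_integral_def[symmetric]
    by (intro set_borel_integral_eq_integral borel_integrable_atLeastAtMost'
        continuous_on_subset[OF \<psi>]) auto
  ultimately show ?thesis using I by (simp add: has_bochner_integral_iff)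
qed

lemma has_sum_integral_Weierstrass:
  fixes f :: "'a \<Rightarrow> real \<Rightarrow> 'b :: banach"
  assumes cont: "\<And>n. continuous_on {a..b} (f n)"
    and majorant: "\<And>n x. n \<in> A \<Longrightarrow> x \<in> {a..b} \<Longrightarrow> norm (f n x) \<le> u n" "u summable_on A"
  shows "((\<lambda>n. integral {a..b} (f n)) has_sum integral {a..b} (\<lambda>x. \<Sum>\<^sub>\<infinity>n\<in>A. f n x)) A"
proof -
  have "uniform_limit {a..b} (\<lambda>X x. \<Sum>n\<in>X. f n x) (\<lambda>x. \<Sum>\<^sub>\<infinity>n\<in>A. f n x) (finite_subsets_at_top A)"
    by (rule Weierstrass_m_test_general[OF majorant])
  then obtain I J where I: "\<And>X. ((\<lambda>x. \<Sum>n\<in>X. f n x) has_integral I X) {a..b}"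
    and J: "((\<lambda>x. \<Sum>\<^sub>\<infinity>n\<in>A. f n x) has_integral J) {a..b}"
    and lim: "(I \<longlongrightarrow> J) (finite_subsets_at_top A)"
  proof (rule uniform_limit_integral)
    show "continuous_on {a..b} (\<lambda>x. \<Sum>n\<in>X. f n x)" for X by (intro continuous_on_sum cont)
  qed (simp, blast)
  have I_eq: "I X = (\<Sum>n\<in>X. integral {a..b} (f n))" if "finite X" for X
    unfolding integral_unique[OF I, symmetric] using that
    by (intro Henstock_Kurzweil_Integration.integral_sum integrable_continuous_interval cont)
  have "((\<lambda>n. integral {a..b} (f n)) has_sum J) A"
    unfolding has_sum_def
    by (rule Lim_transform_eventually[OF lim]) (intro eventually_finite_subsets_at_top_weakI I_eq)
  thus ?thesis by (simp only: integral_unique[OF J])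
qed

lemma fourier_coeff_periodization:
  fixes \<phi> :: "real \<Rightarrow> complex"
  assumes \<phi>: "continuous_on UNIV \<phi>"
    and majorant: "u summable_on UNIV" "\<And>x n. x \<in> {- 1 / 2..1 / 2} \<Longrightarrow> norm (\<phi> (x + of_int n)) \<le> u n"
    and transform: "has_bochner_integral lborel (\<lambda>x. \<phi> x * fourier_char m x) I"
  shows "fourier_coeff (\<lambda>x. \<Sum>\<^sub>\<infinity>n. \<phi> (x + of_int n)) m = I"
proof -
  define \<psi> where "\<psi> = (\<lambda>x. \<phi> x * fourier_char m x)"
  have \<psi>: "continuous_on UNIV \<psi>" unfolding \<psi>_def by (intro continuous_intros \<phi>)
  have \<psi>_shift: "\<psi> (x + of_int n) = \<phi> (x + of_int n) * fourier_char m x" for x n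
    unfolding \<psi>_def fourier_char_add_int ..
  have cont: "continuous_on {- 1 / 2..1 / 2} (\<lambda>x. \<psi> (x + of_int n))" for n
    by (intro continuous_on_compose2[OF \<psi>] continuous_intros) auto
  have norm_le: "norm (\<psi> (x + of_int n)) \<le> u n" if "x \<in> {- 1 / 2..1 / 2}" for x n
    using majorant(2)[OF that] unfolding \<psi>_shift by (simp add: norm_mult)
  define J where "J = integral {- 1 / 2..1 / 2} (\<lambda>x. \<Sum>\<^sub>\<infinity>n. \<psi> (x + of_int n))"
  have "((\<lambda>n. integral {- 1 / 2..1 / 2} (\<lambda>x. \<psi> (x + of_int n))) has_sum J) UNIV"
    unfolding J_def by (rule has_sum_integral_Weierstrass[OF cont norm_le majorant(1)])
  from has_sum_int_imp_symmetric_LIMSEQ[OF this]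
  have "(\<lambda>R. integral {- real R - 1 / 2..real R + 1 / 2} \<psi>) \<longlonglongrightarrow> J"
    unfolding integral_symmetric_unit_intervals[OF \<psi>] .
  moreover have "(\<lambda>R. integral {- real R - 1 / 2..real R + 1 / 2} \<psi>) \<longlonglongrightarrow> I"
    using transform by (intro integral_symmetric_tendsto_lborel[OF \<psi>]) (simp add: \<psi>_def)
  ultimately have "J = I" by (rule LIMSEQ_unique)
  moreover have "(\<Sum>\<^sub>\<infinity>n. \<psi> (x + of_int n)) = (\<Sum>\<^sub>\<infinity>n. \<phi> (x + of_int n)) * fourier_char m x" for x
    unfolding \<psi>_shift by (rule infsum_cmult_left')
  ultimately show ?thesis by (simp add: fourier_coeff_def J_def)
qed

theorem poisson_summation:
  fixes \<phi> :: "complex \<Rightarrow> complex"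
  assumes \<phi>: "\<phi> holomorphic_on UNIV"
    and majorant: "u summable_on UNIV" "\<And>z n. z \<in> cball 0 1 \<Longrightarrow> norm (\<phi> (z + of_int n)) \<le> u n"
    and transform: "\<And>m. has_bochner_integral lborel (\<lambda>x. \<phi> (of_real x) * fourier_char m x) (\<Phi> m)"
    and summable: "\<Phi> summable_on UNIV"
  shows "(\<Sum>\<^sub>\<infinity>n::int. \<phi> (of_int n)) = (\<Sum>\<^sub>\<infinity>m. \<Phi> m)"
proof -
  define P where "P = (\<lambda>z. \<Sum>\<^sub>\<infinity>n. \<phi> (z + of_int n))"
  have holo: "(\<lambda>z. \<Sum>n\<in>X. \<phi> (z + of_int n)) holomorphic_on A" for X and A :: "complex set"
    by (intro holomorphic_on_sum holomorphic_on_compose_gen[OF _ \<phi>, unfolded o_def]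
        holomorphic_intros) auto
  have ulim: "uniform_limit (cball 0 1) (\<lambda>X z. \<Sum>n\<in>X. \<phi> (z + of_int n)) P (finite_subsets_at_top UNIV)"
    unfolding P_def by (rule Weierstrass_m_test_general[OF majorant(2) majorant(1)])
  have "P holomorphic_on ball 0 1"
    by (rule holomorphic_uniform_limit[OF _ ulim])
       (auto intro: holo holomorphic_on_imp_continuous_on)
  hence "(\<lambda>M. \<Sum>m\<in>{- int M..int M}. fourier_coeff (\<lambda>x. P (of_real x)) m) \<longlonglongrightarrow> P 0"
    by (rule fourier_series_at_0)
  moreover have "fourier_coeff (\<lambda>x. P (of_real x)) m = \<Phi> m" for m
  proof -
    have "continuous_on UNIV (\<lambda>x. \<phi> (complex_of_real x))"
      using holomorphic_on_imp_continuous_on[OF \<phi>]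
      by (rule continuous_on_compose2) (auto intro: continuous_intros)
    moreover have "norm (\<phi> (of_real (x + of_int n))) \<le> u n"
      if "x \<in> {- 1 / 2..1 / 2}" for x :: real and n
      using majorant(2)[of "of_real x" n] that by (auto simp: abs_if)
    ultimately have "fourier_coeff (\<lambda>x. \<Sum>\<^sub>\<infinity>n. \<phi> (of_real (x + of_int n))) m = \<Phi> m"
      by (intro fourier_coeff_periodization[OF _ majorant(1) _ transform])
    thus ?thesis by (simp add: P_def)
  qed
  ultimately have "(\<lambda>M. \<Sum>m\<in>{- int M..int M}. \<Phi> m) \<longlonglongrightarrow> P 0" by simp
  moreover have "(\<lambda>M. \<Sum>m\<in>{- int M..int M}. \<Phi> m) \<longlonglongrightarrow> (\<Sum>\<^sub>\<infinity>m. \<Phi> m)"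
    using summable by (intro has_sum_int_imp_symmetric_LIMSEQ has_sum_infsum)
  ultimately show ?thesis using LIMSEQ_unique by (fastforce simp: P_def)
qed

lemma std_normal_char_has_bochner_integral:
  "has_bochner_integral lborel (\<lambda>x. std_normal_density x *\<^sub>R iexp (v * x))
    (complex_of_real (exp (- (v\<^sup>2) / 2)))"
proof -
  have "integrable std_normal_distribution (\<lambda>x. iexp (v * x))"
    using real_dist_normal_dist
    by (intro finite_measure.integrable_const_bound[where B = 1])
       (auto simp: real_distribution_def prob_space_def real_distribution_axioms_def)
  hence "integrable lborel (\<lambda>x. std_normal_density x *\<^sub>R iexp (v * x))"
    by (subst (asm) integrable_density) auto
  moreover have "(\<integral>x. std_normal_density x *\<^sub>R iexp (v * x) \<partial>lborel)
      = complex_of_real (exp (- (v\<^sup>2) / 2))"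
    using fun_cong[OF char_std_normal_distribution, of v] unfolding char_def
    by (subst (asm) integral_density) auto
  ultimately show ?thesis by (simp add: has_bochner_integral_iff)
qed

lemma gauss_fourier_transform_unit_variance:
  fixes c :: complex
  shows "has_bochner_integral lborel (\<lambda>x. exp (- (of_real x)\<^sup>2 / 2 + c * of_real x))
    (of_real (sqrt (2 * pi)) * exp (c\<^sup>2 / 2))"
proof -
  define u where "u = Re c"
  define v where "v = Im c"
  define k where "k = of_real (sqrt (2 * pi)) * exp (of_real (u\<^sup>2 / 2) + \<i> * of_real (u * v))"
  have c: "c = of_real u + \<i> * of_real v" by (simp add: u_def v_def complex_eq_iff)
  from lborel_has_bochner_integral_real_affine_iff[THEN iffD1,
      OF _ std_normal_char_has_bochner_integral, of 1 "- u" v]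
  have "has_bochner_integral lborel (\<lambda>x. std_normal_density (x - u) *\<^sub>R iexp (v * (x - u)))
      (complex_of_real (exp (- (v\<^sup>2) / 2)))"
    by (simp add: add.commute)
  hence "has_bochner_integral lborel (\<lambda>x. k * (std_normal_density (x - u) *\<^sub>R iexp (v * (x - u))))
      (k * complex_of_real (exp (- (v\<^sup>2) / 2)))"
    by (rule has_bochner_integral_mult_right)
  also have "(\<lambda>x. k * (std_normal_density (x - u) *\<^sub>R iexp (v * (x - u))))
      = (\<lambda>x. exp (- (of_real x)\<^sup>2 / 2 + c * of_real x))"
  proof
    fix x :: real
    have "k * (std_normal_density (x - u) *\<^sub>R iexp (v * (x - u)))
        = exp (of_real (u\<^sup>2 / 2) + \<i> * of_real (u * v))
            * (of_real (exp (- ((x - u)\<^sup>2 / 2))) * iexp (v * (x - u)))"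
      by (simp add: k_def std_normal_density_def scaleR_conv_of_real)
    also have "\<dots> = exp (of_real (u\<^sup>2 / 2) + \<i> * of_real (u * v)
        + (of_real (- ((x - u)\<^sup>2 / 2)) + \<i> * of_real (v * (x - u))))"
      by (simp only: exp_add exp_of_real)
    also have "\<dots> = exp (- (of_real x)\<^sup>2 / 2 + c * of_real x)"
      by (rule arg_cong[of _ _ exp]) (simp add: complex_eq_iff c power2_eq_square field_simps)
    finally show "k * (std_normal_density (x - u) *\<^sub>R iexp (v * (x - u)))
        = exp (- (of_real x)\<^sup>2 / 2 + c * of_real x)" .
  qed
  also have "k * complex_of_real (exp (- (v\<^sup>2) / 2))
      = of_real (sqrt (2 * pi))
          * exp (of_real (u\<^sup>2 / 2) + \<i> * of_real (u * v) + of_real (- (v\<^sup>2) / 2))"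
    unfolding k_def exp_add exp_of_real[symmetric] by (simp only: mult.assoc)
  also have "of_real (u\<^sup>2 / 2) + \<i> * of_real (u * v) + of_real (- (v\<^sup>2) / 2) = c\<^sup>2 / 2"
    by (simp add: complex_eq_iff c power2_eq_square field_simps)
  finally show ?thesis .
qed

lemma gauss_fourier_transform:
  fixes s :: real and c :: complex
  assumes s: "s > 0"
  shows "has_bochner_integral lborel (\<lambda>x. exp (- of_real s * (of_real x)\<^sup>2 + c * of_real x))
    (of_real (sqrt (pi / s)) * exp (c\<^sup>2 / (4 * of_real s)))"
proof -
  define r where "r = sqrt (2 * s)"
  have r: "r > 0" "r\<^sup>2 = 2 * s" using s by (simp_all add: r_def)
  have r': "(complex_of_real r)\<^sup>2 = 2 * of_real s"
    by (metis r(2) of_real_mult of_real_numeral of_real_power)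
  from lborel_has_bochner_integral_real_affine_iff[THEN iffD1,
      OF _ gauss_fourier_transform_unit_variance[of "c / of_real r"], of r 0]
  have "has_bochner_integral lborel (\<lambda>x. exp (- (of_real (r * x))\<^sup>2 / 2
      + c / of_real r * of_real (r * x)))
      ((of_real (sqrt (2 * pi)) * exp ((c / of_real r)\<^sup>2 / 2)) /\<^sub>R r)"
    using r(1) by simp
  also have "(\<lambda>x. exp (- (of_real (r * x))\<^sup>2 / 2 + c / of_real r * of_real (r * x)))
      = (\<lambda>x. exp (- of_real s * (of_real x)\<^sup>2 + c * of_real x))"
    using r(1) r' by (auto simp: power_mult_distrib)
  also have "(c / of_real r)\<^sup>2 / 2 = c\<^sup>2 / (4 * of_real s)"
    unfolding power_divide r' by simp
  also have "(of_real (sqrt (2 * pi)) * exp (c\<^sup>2 / (4 * of_real s))) /\<^sub>R r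
      = of_real (sqrt (2 * pi) / r) * exp (c\<^sup>2 / (4 * of_real s))"
    by (simp only: scaleR_conv_of_real divide_inverse of_real_mult mult_ac)
  also have "sqrt (2 * pi) / r = sqrt (pi / s)"
    unfolding r_def real_sqrt_divide[symmetric] by simp
  finally show ?thesis .
qed

lemma norm_exp_quadratic_le:
  fixes c z :: complex
  assumes s: "s > 0"
  shows "norm (exp (- of_real s * z\<^sup>2 + c * z))
    \<le> exp (s * (Im z)\<^sup>2 + \<bar>Im c\<bar> * \<bar>Im z\<bar> + (\<bar>Re c\<bar> + 1)\<^sup>2 / (4 * s)) * exp (- \<bar>Re z\<bar>)"
proof -
  define B where "B = \<bar>Re c\<bar> + 1"
  have "0 \<le> (B - 2 * s * \<bar>Re z\<bar>)\<^sup>2" by simp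
  hence "4 * s * (B * \<bar>Re z\<bar> - s * (Re z)\<^sup>2) \<le> B\<^sup>2"
    by (simp add: power2_diff power_mult_distrib power2_eq_square algebra_simps)
  hence "B * \<bar>Re z\<bar> - s * (Re z)\<^sup>2 \<le> B\<^sup>2 / (4 * s)" using s by (simp add: field_simps)
  moreover have "Re c * Re z \<le> \<bar>Re c\<bar> * \<bar>Re z\<bar>" "- (Im c * Im z) \<le> \<bar>Im c\<bar> * \<bar>Im z\<bar>"
    using abs_ge_self[of "Re c * Re z"] abs_ge_minus_self[of "Im c * Im z"]
    by (simp_all add: abs_mult)
  ultimately have "Re (- of_real s * z\<^sup>2 + c * z)
      \<le> s * (Im z)\<^sup>2 + \<bar>Im c\<bar> * \<bar>Im z\<bar> + B\<^sup>2 / (4 * s) + - \<bar>Re z\<bar>"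
    by (simp add: B_def distrib_right power2_eq_square right_diff_distrib)
  thus ?thesis unfolding norm_exp_eq_Re exp_add[symmetric] B_def by simp
qed

lemma norm_exp_quadratic_translate_le:
  fixes c :: complex
  assumes s: "s > 0"
  obtains C where "\<And>z n. z \<in> cball 0 1 \<Longrightarrow>
    norm (exp (- of_real s * (z + of_int n)\<^sup>2 + c * (z + of_int n))) \<le> C * exp (- \<bar>real_of_int n\<bar>)"
proof (rule that)
  fix z :: complex and n :: int
  define B where "B = (\<bar>Re c\<bar> + 1)\<^sup>2 / (4 * s)"
  assume "z \<in> cball 0 1"
  hence z: "\<bar>Re z\<bar> \<le> 1" "\<bar>Im z\<bar> \<le> 1"
    using abs_Re_le_cmod[of z] abs_Im_le_cmod[of z] by auto
  have "s * (Im z)\<^sup>2 \<le> s * 1" using z s by (intro mult_left_mono) (auto simp: abs_square_le_1)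
  moreover have "\<bar>Im c\<bar> * \<bar>Im z\<bar> \<le> \<bar>Im c\<bar> * 1" using z by (intro mult_left_mono) auto
  moreover have "- \<bar>Re z + of_int n\<bar> \<le> 1 - \<bar>real_of_int n\<bar>" using z by linarith
  ultimately have "exp (s * (Im z)\<^sup>2 + \<bar>Im c\<bar> * \<bar>Im z\<bar> + B) * exp (- \<bar>Re z + of_int n\<bar>)
      \<le> exp (s + \<bar>Im c\<bar> + B) * exp (1 - \<bar>real_of_int n\<bar>)"
    unfolding exp_add[symmetric] by simp
  also have "\<dots> = exp (s + \<bar>Im c\<bar> + B + 1) * exp (- \<bar>real_of_int n\<bar>)"
    unfolding exp_add[symmetric] by simp
  finally show "norm (exp (- of_real s * (z + of_int n)\<^sup>2 + c * (z + of_int n)))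
      \<le> exp (s + \<bar>Im c\<bar> + B + 1) * exp (- \<bar>real_of_int n\<bar>)"
    using norm_exp_quadratic_le[OF s, of "z + of_int n" c] by (simp add: B_def)
qed

lemma summable_exp_minus_abs_int: "(\<lambda>n::int. exp (- \<bar>real_of_int n\<bar>)) summable_on UNIV"
proof -
  have "exp (- 1) ^ nat \<bar>n\<bar> = exp (- \<bar>real_of_int n\<bar>)" for n by (simp flip: exp_of_nat_mult)
  thus ?thesis using summable_on_int_abs[OF summable_geometric[of "exp (- 1)"]] by simp
qed

lemma gauss_int_norm_summable:
  fixes c :: complex
  assumes s: "s > 0"
  shows "(\<lambda>n::int. norm (exp (- of_real s * (of_int n)\<^sup>2 + c * of_int n))) summable_on UNIV"
proof -
  obtain C where C: "\<And>z n. z \<in> cball 0 1 \<Longrightarrow>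
      norm (exp (- of_real s * (z + of_int n)\<^sup>2 + c * (z + of_int n))) \<le> C * exp (- \<bar>real_of_int n\<bar>)"
    using norm_exp_quadratic_translate_le[OF s] by blast
  show ?thesis
    by (rule summable_on_comparison_test[OF summable_on_cmult_right[OF summable_exp_minus_abs_int]])
       (use C[of 0] in auto)
qed

lemma poisson_gauss:
  fixes s :: real and c :: complex
  defines "\<Phi> \<equiv> \<lambda>m::int. of_real (sqrt (pi / s))
      * exp ((c - 2 * of_real pi * \<i> * of_int m)\<^sup>2 / (4 * of_real s))"
  assumes s: "s > 0"
  shows "(\<lambda>m. norm (\<Phi> m)) summable_on UNIV"
    and "(\<Sum>\<^sub>\<infinity>n::int. exp (- of_real s * (of_int n)\<^sup>2 + c * of_int n)) = (\<Sum>\<^sub>\<infinity>m. \<Phi> m)"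
proof -
  have "(c - 2 * of_real pi * \<i> * of_int m)\<^sup>2 / (4 * of_real s)
      = c\<^sup>2 / (4 * of_real s) + (- of_real (pi\<^sup>2 / s) * (of_int m)\<^sup>2
          + - (of_real pi * \<i> * c / of_real s) * of_int m)" for m
    using s by (simp add: power2_eq_square field_simps)
  hence "norm (\<Phi> m) = norm (of_real (sqrt (pi / s)) * exp (c\<^sup>2 / (4 * of_real s)))
      * norm (exp (- of_real (pi\<^sup>2 / s) * (of_int m)\<^sup>2
          + - (of_real pi * \<i> * c / of_real s) * of_int m))" for m
    unfolding \<Phi>_def by (simp only: exp_add norm_mult mult.assoc)
  thus norm_summable: "(\<lambda>m. norm (\<Phi> m)) summable_on UNIV"
    using s by (simp only:) (intro summable_on_cmult_right gauss_int_norm_summable, simp)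
  obtain C where C: "\<And>z n. z \<in> cball 0 1 \<Longrightarrow>
      norm (exp (- of_real s * (z + of_int n)\<^sup>2 + c * (z + of_int n))) \<le> C * exp (- \<bar>real_of_int n\<bar>)"
    using norm_exp_quadratic_translate_le[OF s] by blast
  show "(\<Sum>\<^sub>\<infinity>n. exp (- of_real s * (of_int n)\<^sup>2 + c * of_int n)) = (\<Sum>\<^sub>\<infinity>m. \<Phi> m)"
  proof (rule poisson_summation[OF _ summable_on_cmult_right[OF summable_exp_minus_abs_int] C])
    show "(\<lambda>z. exp (- of_real s * z\<^sup>2 + c * z)) holomorphic_on UNIV" by (intro holomorphic_intros)
    show "\<Phi> summable_on UNIV" by (rule abs_summable_summable[OF norm_summable])
    fix m
    show "has_bochner_integral lborel (\<lambda>x. exp (- of_real s * (of_real x)\<^sup>2 + c * of_real x)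
        * fourier_char m x) (\<Phi> m)"
      unfolding \<Phi>_def using gauss_fourier_transform[OF s, of "c - 2 * of_real pi * \<i> * of_int m"]
      by (simp add: algebra_simps flip: exp_add)
  qed
qed

section \<open>Partial Gaussian sums outside the unit disc\<close>

lemma summable_on_comp_inj:
  fixes f :: "'a \<Rightarrow> 'b :: banach"
  assumes "f summable_on UNIV" "inj g"
  shows "(\<lambda>x. f (g x)) summable_on UNIV"
  using summable_on_reindex[OF assms(2), of f] summable_on_subset_banach[OF assms(1), of "range g"]
  by (simp add: o_def)

lemma infsum_int_eq_suminf:
  fixes f :: "int \<Rightarrow> 'a :: banach"
  assumes "f summable_on UNIV"
  shows "(\<Sum>\<^sub>\<infinity>n. f n) = (\<Sum>n. f (int n)) + (\<Sum>n. f (- int (Suc n)))"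
proof -
  have "((\<lambda>n. f (g n)) has_sum (\<Sum>n. f (g n))) UNIV" if "inj g" for g :: "nat \<Rightarrow> int"
    using has_sum_infsum[OF summable_on_comp_inj[OF assms that]]
    by (metis has_sum_imp_sums sums_unique)
  thus ?thesis by (intro infsumI has_sum_int) (auto simp: inj_on_def)
qed

lemma bilateral_gauss_term_eq:
  fixes c :: complex
  shows "exp c powi n * of_real (exp (- s * (real_of_int n + a)\<^sup>2))
    = of_real (exp (- s * a\<^sup>2))
        * exp (- of_real s * (of_int n)\<^sup>2 + (c - of_real (2 * s * a)) * of_int n)"
proof -
  have "exp c powi n = exp (of_int n * c)" by (simp add: exp_power_int)
  thus ?thesis by (simp add: algebra_simps power2_eq_square flip: exp_add exp_of_real)
qed

lemma bilateral_gauss_norm_summable: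
  fixes w :: complex
  assumes s: "s > 0" and w: "w \<noteq> 0"
  shows "(\<lambda>n::int. norm (w powi n * of_real (exp (- s * (real_of_int n + a)\<^sup>2)))) summable_on UNIV"
proof -
  obtain c where c: "w = exp c" using w exp_Ln by metis
  show ?thesis unfolding c bilateral_gauss_term_eq norm_mult
    by (intro summable_on_cmult_right gauss_int_norm_summable s)
qed

lemma shifted_gauss_summable:
  fixes w :: complex
  assumes s: "s > 0" and w: "w \<noteq> 0"
  shows "summable (\<lambda>n. w ^ n * of_real (exp (- s * (real n + a)\<^sup>2)))"
proof -
  have "(\<lambda>n. w powi int n * complex_of_real (exp (- s * (real_of_int (int n) + a)\<^sup>2)))
      summable_on UNIV"
    by (rule summable_on_comp_inj[OF
          abs_summable_summable[OF bilateral_gauss_norm_summable[OF assms]]]) simp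
  thus ?thesis by (auto dest: summable_on_imp_summable)
qed

lemma bilateral_gauss_sum_eq:
  fixes w :: complex
  assumes s: "s > 0" and w: "w \<noteq> 0"
  shows "(\<Sum>\<^sub>\<infinity>n::int. w powi n * of_real (exp (- s * (real_of_int n + a)\<^sup>2)))
    = shifted_gauss_sum w a s + inverse w * shifted_gauss_sum (inverse w) (1 - a) s"
proof -
  have "w powi (- int (Suc n)) * of_real (exp (- s * (real_of_int (- int (Suc n)) + a)\<^sup>2))
      = inverse w * (inverse w ^ n * of_real (exp (- s * (real n + (1 - a))\<^sup>2)))" for n
  proof -
    have "(real_of_int (- int (Suc n)) + a)\<^sup>2 = (real n + (1 - a))\<^sup>2"
      by (simp add: power2_eq_square algebra_simps)
    moreover have "w powi (- int (Suc n)) = inverse w * inverse w ^ n"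
      unfolding power_int_minus power_int_of_nat by (simp add: power_inverse)
    ultimately show ?thesis by (simp only: mult.assoc)
  qed
  moreover have "summable (\<lambda>n. inverse w ^ n * of_real (exp (- s * (real n + (1 - a))\<^sup>2)))"
    using assms by (intro shifted_gauss_summable) auto
  ultimately show ?thesis
    using infsum_int_eq_suminf[OF
        abs_summable_summable[OF bilateral_gauss_norm_summable[OF assms, of a]]]
    by (simp add: shifted_gauss_sum_def suminf_mult)
qed

definition gauss_dual_term :: "real \<Rightarrow> complex \<Rightarrow> real \<Rightarrow> int \<Rightarrow> complex" where
  "gauss_dual_term a \<zeta> s m = of_real (sqrt (pi / s))
     * exp (- (of_real (pi\<^sup>2) * (\<zeta> - of_int m)\<^sup>2 / of_real s)
            - 2 * of_real pi * \<i> * of_real a * (\<zeta> - of_int m))"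

lemma bilateral_gauss_sum_poisson:
  fixes \<zeta> :: complex
  assumes s: "s > 0"
  shows "(\<lambda>m. norm (gauss_dual_term a \<zeta> s m)) summable_on UNIV"
    and "(\<Sum>\<^sub>\<infinity>n::int. exp (2 * of_real pi * \<i> * \<zeta>) powi n
        * of_real (exp (- s * (real_of_int n + a)\<^sup>2)))
      = (\<Sum>\<^sub>\<infinity>m. gauss_dual_term a \<zeta> s m)"
proof -
  define c where "c = 2 * of_real pi * \<i> * \<zeta> - of_real (2 * s * a)"
  have exponent: "- of_real (s * a\<^sup>2) + (c - 2 * of_real pi * \<i> * of_int m)\<^sup>2 / (4 * of_real s)
      = - (of_real (pi\<^sup>2) * (\<zeta> - of_int m)\<^sup>2 / of_real s)
        - 2 * of_real pi * \<i> * of_real a * (\<zeta> - of_int m)" for m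
  proof -
    have "c - 2 * of_real pi * \<i> * of_int m = 2 * (of_real pi * \<i> * (\<zeta> - of_int m) - of_real (s * a))"
      by (simp add: c_def algebra_simps)
    moreover have "(2 * (of_real pi * \<i> * u - of_real (s * a)))\<^sup>2 / (4 * of_real s)
        = of_real (s * a\<^sup>2) - of_real (pi\<^sup>2) * u\<^sup>2 / of_real s
          - 2 * of_real pi * \<i> * of_real a * u" for u
      using s by (simp add: power2_eq_square field_simps)
    ultimately show ?thesis by simp
  qed
  have dual: "gauss_dual_term a \<zeta> s m
      = of_real (exp (- s * a\<^sup>2)) * (of_real (sqrt (pi / s))
          * exp ((c - 2 * of_real pi * \<i> * of_int m)\<^sup>2 / (4 * of_real s)))" for m
    unfolding gauss_dual_term_def exponent[symmetric] exp_add by (simp flip: exp_of_real)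
  show "(\<lambda>m. norm (gauss_dual_term a \<zeta> s m)) summable_on UNIV"
    unfolding dual norm_mult[of "of_real (exp (- s * a\<^sup>2))"]
    by (intro summable_on_cmult_right poisson_gauss s)
  show "(\<Sum>\<^sub>\<infinity>n::int. exp (2 * of_real pi * \<i> * \<zeta>) powi n * of_real (exp (- s * (real_of_int n + a)\<^sup>2)))
      = (\<Sum>\<^sub>\<infinity>m. gauss_dual_term a \<zeta> s m)"
    unfolding bilateral_gauss_term_eq dual c_def
    by (simp only: infsum_cmult_right' poisson_gauss(2)[OF s])
qed

lemma finite_positive_lower_bound:
  fixes f :: "'a \<Rightarrow> real"
  assumes fin: "finite {x \<in> S. f x < c}" and "c > 0" and "\<And>x. x \<in> S \<Longrightarrow> f x > 0"
  obtains \<delta> where "\<delta> > 0" "\<And>x. x \<in> S \<Longrightarrow> f x \<ge> \<delta>"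
proof (rule that)
  let ?V = "insert c (f ` {x \<in> S. f x < c})"
  show "Min ?V > 0" using assms by (subst Min_gr_iff) auto
  show "f x \<ge> Min ?V" if "x \<in> S" for x
  proof (cases "f x < c")
    case True
    thus ?thesis using fin that by (intro Min_le) auto
  next
    case False
    have "Min ?V \<le> c" using fin by (intro Min_le) auto
    thus ?thesis using False by linarith
  qed
qed

lemma square_diff_lower_bound:
  fixes X Y :: real
  obtains \<delta> where "\<delta> > 0"
    "\<And>m. \<bar>real_of_int m - X\<bar> > \<bar>Y\<bar> \<Longrightarrow> (real_of_int m - X)\<^sup>2 - Y\<^sup>2 \<ge> \<delta> * (1 + (real_of_int m)\<^sup>2)"
proof -
  define S where "S = {m. \<bar>real_of_int m - X\<bar> > \<bar>Y\<bar>}"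
  define q where "q = (\<lambda>m. ((real_of_int m - X)\<^sup>2 - Y\<^sup>2) / (1 + (real_of_int m)\<^sup>2))"
  have denom: "1 + (real_of_int m)\<^sup>2 > 0" for m by (simp add: add_pos_nonneg)
  obtain K :: nat where K: "1 + 4 * X\<^sup>2 + 4 * Y\<^sup>2 \<le> real K" using real_arch_simple by blast
  have "{m \<in> S. q m < 1 / 4} \<subseteq> {- int K..int K}"
  proof
    fix m assume "m \<in> {m \<in> S. q m < 1 / 4}"
    hence "4 * (real_of_int m - X)\<^sup>2 - 4 * Y\<^sup>2 < 1 + (real_of_int m)\<^sup>2"
      using denom[of m] by (simp add: q_def pos_divide_less_eq)
    moreover have "(real_of_int m)\<^sup>2 \<le> 2 * (real_of_int m - X)\<^sup>2 + 2 * X\<^sup>2"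
      using zero_le_power2[of "real_of_int m - 2 * X"] by (simp add: power2_eq_square algebra_simps)
    ultimately have "(real_of_int m)\<^sup>2 < real K" using K by linarith
    hence "m\<^sup>2 < int K" by (metis of_int_less_iff of_int_of_nat_eq of_int_power)
    moreover have "\<bar>m\<bar> \<le> m\<^sup>2" using self_le_power[of "\<bar>m\<bar>" 2] by (cases "m = 0") auto
    ultimately show "m \<in> {- int K..int K}" by auto
  qed
  hence "finite {m \<in> S. q m < 1 / 4}" by (rule finite_subset) simp
  moreover have "q m > 0" if "m \<in> S" for m
    using that denom[of m] abs_le_square_iff[of "real_of_int m - X" Y] by (simp add: S_def q_def)
  ultimately obtain \<delta> where "\<delta> > 0" "\<And>m. m \<in> S \<Longrightarrow> q m \<ge> \<delta>"
    using finite_positive_lower_bound[of S q "1 / 4"] by auto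
  thus ?thesis using denom that[of \<delta>] by (simp add: S_def q_def pos_le_divide_eq)
qed

lemma exp_minus_le_fact_divide_power:
  fixes x :: real
  assumes "x > 0"
  shows "exp (- x) \<le> fact k / x ^ k"
  using power_le_fact_mult_exp[of x k] assms by (simp add: exp_minus field_simps)

lemma exp_minus_divide_le_power:
  fixes s x e :: real
  assumes s: "0 < s" and x: "0 < \<delta>" "\<delta> * e \<le> x" and e: "e \<ge> 1"
  shows "exp (- x / s) \<le> fact (n + 1) / \<delta> ^ (n + 1) * s ^ (n + 1) / e"
proof -
  have pos: "\<delta> * e / s > 0" using assms by simp
  have "exp (- x / s) \<le> exp (- (\<delta> * e / s))" using s x by (simp add: divide_right_mono)
  also have "\<dots> \<le> fact (n + 1) / (\<delta> * e / s) ^ (n + 1)"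
    by (rule exp_minus_le_fact_divide_power[OF pos])
  also have "\<dots> = fact (n + 1) / \<delta> ^ (n + 1) * s ^ (n + 1) / e ^ (n + 1)"
    by (simp add: power_mult_distrib power_divide)
  also have "\<dots> \<le> fact (n + 1) / \<delta> ^ (n + 1) * s ^ (n + 1) / e"
    using e s x by (intro divide_left_mono self_le_power) auto
  finally show ?thesis .
qed

lemma norm_gauss_dual_term:
  assumes "s > 0"
  shows "norm (gauss_dual_term a \<zeta> s m) = sqrt (pi / s)
    * (exp (- (pi\<^sup>2 * ((real_of_int m - Re \<zeta>)\<^sup>2 - (Im \<zeta>)\<^sup>2)) / s) * exp (2 * pi * a * Im \<zeta>))"
proof -
  have sq: "Re ((\<zeta> - of_int m)\<^sup>2) = (real_of_int m - Re \<zeta>)\<^sup>2 - (Im \<zeta>)\<^sup>2"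
    by (simp add: power2_eq_square algebra_simps)
  have "Re (of_real (pi\<^sup>2) * (\<zeta> - of_int m)\<^sup>2 / of_real s)
      = pi\<^sup>2 * ((real_of_int m - Re \<zeta>)\<^sup>2 - (Im \<zeta>)\<^sup>2) / s"
    unfolding Re_divide_of_real sq[symmetric] by (simp flip: of_real_power)
  moreover have "Re (2 * of_real pi * \<i> * of_real a * (\<zeta> - of_int m)) = - (2 * pi * a * Im \<zeta>)"
    by simp
  ultimately have "norm (exp (- (of_real (pi\<^sup>2) * (\<zeta> - of_int m)\<^sup>2 / of_real s)
        - 2 * of_real pi * \<i> * of_real a * (\<zeta> - of_int m)))
      = exp (- (pi\<^sup>2 * ((real_of_int m - Re \<zeta>)\<^sup>2 - (Im \<zeta>)\<^sup>2)) / s) * exp (2 * pi * a * Im \<zeta>)"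
    by (simp only: norm_exp_eq_Re uminus_complex.sel minus_complex.sel flip: exp_add) simp
  thus ?thesis using assms by (simp only: gauss_dual_term_def norm_mult norm_of_real) simp
qed

text \<open>The frequencies whose dual terms do not decay as \<open>s \<rightarrow> 0\<close>, namely \<open>Re ((m - \<zeta>)\<^sup>2) \<le> 0\<close>.\<close>

definition nondecaying_ints :: "complex \<Rightarrow> int set" where
  "nondecaying_ints \<zeta> = {m. \<bar>real_of_int m - Re \<zeta>\<bar> \<le> \<bar>Im \<zeta>\<bar>}"

lemma finite_nondecaying_ints: "finite (nondecaying_ints \<zeta>)"
proof (rule finite_subset)
  show "nondecaying_ints \<zeta> \<subseteq> {\<lfloor>Re \<zeta> - \<bar>Im \<zeta>\<bar>\<rfloor>..\<lceil>Re \<zeta> + \<bar>Im \<zeta>\<bar>\<rceil>}"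
    by (auto simp: nondecaying_ints_def floor_le_iff le_ceiling_iff)
qed simp

lemma norm_gauss_dual_term_le:
  fixes \<zeta> :: complex
  obtains C where "\<And>s m. 0 < s \<Longrightarrow> s \<le> 1 \<Longrightarrow> m \<notin> nondecaying_ints \<zeta> \<Longrightarrow>
    norm (gauss_dual_term a \<zeta> s m) \<le> C * s ^ N * (1 / (1 + (real_of_int m)\<^sup>2))"
proof -
  obtain \<delta> where \<delta>: "\<delta> > 0" "\<And>m. \<bar>real_of_int m - Re \<zeta>\<bar> > \<bar>Im \<zeta>\<bar> \<Longrightarrow>
      (real_of_int m - Re \<zeta>)\<^sup>2 - (Im \<zeta>)\<^sup>2 \<ge> \<delta> * (1 + (real_of_int m)\<^sup>2)"
    by (rule square_diff_lower_bound[of "Im \<zeta>" "Re \<zeta>"]) blast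
  define E where "E = exp (2 * pi * a * Im \<zeta>)"
  define C where "C = sqrt pi * (fact (N + 1) / \<delta> ^ (N + 1)) * E"
  show ?thesis
  proof (rule that)
    fix s :: real and m assume s: "0 < s" "s \<le> 1" and "m \<notin> nondecaying_ints \<zeta>"
    hence m: "\<bar>real_of_int m - Re \<zeta>\<bar> > \<bar>Im \<zeta>\<bar>" by (simp add: nondecaying_ints_def)
    define e where "e = 1 + (real_of_int m)\<^sup>2"
    define x where "x = pi\<^sup>2 * ((real_of_int m - Re \<zeta>)\<^sup>2 - (Im \<zeta>)\<^sup>2)"
    have e: "e \<ge> 1" by (simp add: e_def)
    have "1 \<le> pi\<^sup>2" using pi_ge_two by (intro one_le_power) auto
    hence "1 * (\<delta> * e) \<le> x" unfolding x_def e_def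
      by (intro mult_mono \<delta>(2)[OF m]) (use \<delta>(1) in auto)
    hence "exp (- x / s) \<le> fact (N + 1) / \<delta> ^ (N + 1) * s ^ (N + 1) / e"
      using exp_minus_divide_le_power[OF s(1) \<delta>(1) _ e] by simp
    moreover have "sqrt (pi / s) \<le> sqrt pi / s"
    proof -
      have "s \<le> sqrt s" using s by (intro real_le_rsqrt) (simp add: power2_eq_square mult_left_le)
      thus ?thesis using s by (simp add: real_sqrt_divide divide_left_mono)
    qed
    ultimately have "sqrt (pi / s) * (exp (- x / s) * E)
        \<le> sqrt pi / s * (fact (N + 1) / \<delta> ^ (N + 1) * s ^ (N + 1) / e * E)"
      using s by (intro mult_mono mult_right_mono) (auto simp: E_def)
    also have "\<dots> = C * s ^ N * (1 / e)" using s by (simp add: C_def)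
    also have "sqrt (pi / s) * (exp (- x / s) * E) = norm (gauss_dual_term a \<zeta> s m)"
      using s by (simp add: norm_gauss_dual_term x_def E_def)
    finally show "norm (gauss_dual_term a \<zeta> s m) \<le> C * s ^ N * (1 / (1 + (real_of_int m)\<^sup>2))"
      by (simp add: e_def)
  qed
qed

lemma summable_inverse_one_plus_square_int: "(\<lambda>m::int. 1 / (1 + (real_of_int m)\<^sup>2)) summable_on UNIV"
  using summable_on_int_abs[OF summable_inverse_one_plus_square] by simp

lemma gauss_dual_tail_bigo:
  "(\<lambda>s. infsum (gauss_dual_term a \<zeta> s) (- nondecaying_ints \<zeta>)) \<in> O[at_right 0](\<lambda>s. of_real s ^ N)"
proof -
  define B where "B = - nondecaying_ints \<zeta>"
  define T where "T = (\<Sum>\<^sub>\<infinity>m\<in>B. 1 / (1 + (real_of_int m)\<^sup>2))"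
  obtain C where C: "\<And>s m. 0 < s \<Longrightarrow> s \<le> 1 \<Longrightarrow> m \<notin> nondecaying_ints \<zeta> \<Longrightarrow>
      norm (gauss_dual_term a \<zeta> s m) \<le> C * s ^ N * (1 / (1 + (real_of_int m)\<^sup>2))"
    using norm_gauss_dual_term_le by blast
  have T: "((\<lambda>m. 1 / (1 + (real_of_int m)\<^sup>2)) has_sum T) B"
    unfolding T_def
    by (intro has_sum_infsum summable_on_subset_banach[OF summable_inverse_one_plus_square_int]) simp
  have "norm (infsum (gauss_dual_term a \<zeta> s) B) \<le> C * T * s ^ N" if s: "0 < s" "s \<le> 1" for s
  proof -
    have "gauss_dual_term a \<zeta> s summable_on B"
      by (rule summable_on_subset_banach[OF
            abs_summable_summable[OF bilateral_gauss_sum_poisson(1)[OF s(1)]]]) simp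
    from norm_infsum_le[OF has_sum_infsum[OF this] has_sum_cmult_right[OF T] C[OF s]]
    show ?thesis by (simp add: B_def mult_ac)
  qed
  thus ?thesis unfolding B_def by (rule bigo_at_right_0_powerI)
qed

lemma apostol_bernoulli_fps_neq_1:
  assumes "w \<noteq> 1"
  shows "apostol_bernoulli_fps w a = fps_X * (fps_exp a / (fps_const w * fps_exp 1 - 1))"
  using assms by (simp add: apostol_bernoulli_fps_def fps_divide_unit mult.assoc)

lemma apostol_bernoulli_fps_reflect:
  assumes w: "w \<noteq> 0"
  shows "apostol_bernoulli_fps (inverse w) (1 - a)
    = fps_const w * (apostol_bernoulli_fps w a oo (fps_const (- 1) * fps_X))"
proof -
  let ?\<beta> = "apostol_bernoulli_fps w a" and ?G = "fps_const (inverse w) * fps_exp 1 - 1 :: complex fps"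
  define c where "c = fps_const (- 1) * (fps_X :: complex fps)"
  have c0: "fps_nth c 0 = 0" and c: "c = - fps_X" by (simp_all add: c_def fps_eq_iff)
  have exp_c: "fps_exp x oo c = fps_exp (- x)" for x :: complex
    by (simp add: c_def fps_exp_compose_linear)
  have "(?\<beta> * (fps_const w * fps_exp 1 - 1)) oo c = (?\<beta> oo c) * (fps_const w * fps_exp (- 1) - 1)"
    by (simp add: fps_compose_mult_distrib[OF c0] fps_compose_sub_distrib exp_c)
  moreover have "(fps_X * fps_exp a) oo c = - fps_X * fps_exp (- a)"
    by (simp add: fps_compose_mult_distrib[OF c0] exp_c) (simp add: c)
  ultimately have reflected: "(?\<beta> oo c) * (fps_const w * fps_exp (- 1) - 1) = - fps_X * fps_exp (- a)"
    by (simp add: apostol_bernoulli_fps_mult)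
  have "fps_const w * ?G = (fps_const w * fps_const (inverse w)) * fps_exp 1 - fps_const w"
    by (simp only: right_diff_distrib mult.assoc mult_1_right)
  also have "\<dots> = fps_exp 1 - fps_const w" using w by simp
  also have "\<dots> = fps_exp 1 - fps_const w * (fps_exp 1 * fps_exp (- 1))"
    by (simp flip: fps_exp_add_mult)
  also have "\<dots> = - fps_exp 1 * (fps_const w * fps_exp (- 1) - 1)"
    by (simp only: right_diff_distrib mult_minus_left mult_1_right mult.left_commute) simp
  finally have "fps_const w * (?\<beta> oo c) * ?G
      = - fps_exp 1 * ((?\<beta> oo c) * (fps_const w * fps_exp (- 1) - 1))"
    by (metis mult.assoc mult.left_commute)
  also have "\<dots> = fps_X * (fps_exp 1 * fps_exp (- a))" unfolding reflected by (simp add: mult_ac)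
  also have "\<dots> = apostol_bernoulli_fps (inverse w) (1 - a) * ?G"
    unfolding apostol_bernoulli_fps_mult by (simp flip: fps_exp_add_mult)
  finally show ?thesis
    using fps_const_mult_exp_minus_1_neq_0[of "inverse w"] by (simp add: c_def)
qed

lemma gauss_sum_expansion_reflect:
  assumes "w \<noteq> 0" "w \<noteq> 1"
  shows "gauss_sum_expansion (inverse w) (1 - a) N s = - w * gauss_sum_expansion w a N s"
proof -
  have nth: "fps_nth (apostol_bernoulli_fps (inverse w) (of_real (1 - a))) n
      = w * ((- 1) ^ n * fps_nth (apostol_bernoulli_fps w (of_real a)) n)" for n
    using apostol_bernoulli_fps_reflect[OF assms(1), of "of_real a"]
    by (simp add: fps_compose_linear)
  show ?thesis unfolding gauss_sum_expansion_def nth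
    using assms by (simp add: apostol_bernoulli_fps_neq_1 sum_distrib_left sum_negf mult_ac)
qed

lemma shifted_gauss_sum_eq_dual:
  fixes \<zeta> :: complex
  defines "w \<equiv> exp (2 * of_real pi * \<i> * \<zeta>)"
  assumes s: "s > 0" and A: "finite A"
  shows "shifted_gauss_sum w a s + inverse w * shifted_gauss_sum (inverse w) (1 - a) s
    = sum (gauss_dual_term a \<zeta> s) A + infsum (gauss_dual_term a \<zeta> s) (- A)"
proof -
  have "gauss_dual_term a \<zeta> s summable_on X" for X
    using summable_on_subset_banach[OF abs_summable_summable[OF bilateral_gauss_sum_poisson(1)[OF s]]]
    by blast
  hence "infsum (gauss_dual_term a \<zeta> s) (A \<union> - A)
      = infsum (gauss_dual_term a \<zeta> s) A + infsum (gauss_dual_term a \<zeta> s) (- A)"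
    by (intro infsum_Un_disjoint) auto
  moreover have "w \<noteq> 0" by (simp add: w_def)
  ultimately show ?thesis
    using bilateral_gauss_sum_eq[OF s, of w a] bilateral_gauss_sum_poisson(2)[OF s, of \<zeta> a] A
    by (simp add: w_def)
qed

lemma shifted_gauss_sum_asymp_outside_unit_disc:
  fixes \<zeta> :: complex
  defines "w \<equiv> exp (2 * of_real pi * \<i> * \<zeta>)"
  assumes \<zeta>: "Im \<zeta> < 0"
  shows "(\<lambda>s. shifted_gauss_sum w a s
      - (sum (gauss_dual_term a \<zeta> s) (nondecaying_ints \<zeta>) + gauss_sum_expansion w a N s))
    \<in> O[at_right 0](\<lambda>s. of_real s ^ (N + 1))"
proof -
  define A where "A = nondecaying_ints \<zeta>"
  define tail where "tail = (\<lambda>s. infsum (gauss_dual_term a \<zeta> s) (- A))"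
  define reflected where "reflected = (\<lambda>s. shifted_gauss_sum (inverse w) (1 - a) s
      - gauss_sum_expansion (inverse w) (1 - a) N s)"
  have "norm w > 1" using \<zeta> by (simp add: w_def mult_pos_neg)
  hence w: "w \<noteq> 0" "w \<noteq> 1" "norm (inverse w) \<le> 1"
    by (auto simp: norm_inverse inverse_le_1_iff)
  have eq: "shifted_gauss_sum w a s - (sum (gauss_dual_term a \<zeta> s) A + gauss_sum_expansion w a N s)
      = tail s - inverse w * reflected s" if s: "s > 0" for s
  proof -
    have "shifted_gauss_sum w a s + inverse w * shifted_gauss_sum (inverse w) (1 - a) s
        = sum (gauss_dual_term a \<zeta> s) A + tail s"
      unfolding w_def A_def tail_def
      by (rule shifted_gauss_sum_eq_dual[OF s finite_nondecaying_ints])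
    thus ?thesis using w(1)
      by (simp add: reflected_def gauss_sum_expansion_reflect[OF w(1,2)] algebra_simps)
  qed
  have "tail \<in> O[at_right 0](\<lambda>s. of_real s ^ (N + 1))"
    using gauss_dual_tail_bigo[of a \<zeta> "N + 1"] by (simp add: tail_def A_def)
  moreover have "(\<lambda>s. inverse w * reflected s) \<in> O[at_right 0](\<lambda>s. of_real s ^ (N + 1))"
    unfolding reflected_def using shifted_gauss_sum_asymp_unit_disc[OF w(3)] by simp
  ultimately have "(\<lambda>s. tail s - inverse w * reflected s) \<in> O[at_right 0](\<lambda>s. of_real s ^ (N + 1))"
    by (rule sum_in_bigo)
  moreover have "\<forall>\<^sub>F s in at_right 0.
      shifted_gauss_sum w a s - (sum (gauss_dual_term a \<zeta> s) A + gauss_sum_expansion w a N s)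
      = tail s - inverse w * reflected s"
    using eventually_at_right_less[of 0] by eventually_elim (rule eq)
  ultimately show ?thesis unfolding A_def by (simp only: landau_o.big.in_cong)
qed

section \<open>Taylor coefficients of the sine quotient\<close>

lemma deriv_translate: "deriv (\<lambda>x. f (z + x)) = (\<lambda>x. deriv f (z + x))"
proof
  fix x
  show "deriv (\<lambda>x. f (z + x)) x = deriv f (z + x)"
    using higher_deriv_shift_0[of 1 "\<lambda>x. f (z + x)" x] higher_deriv_shift_0[of 1 f "z + x"]
    by (simp add: o_def add.assoc)
qed

lemma Dz_funpow_eq_fps_nth:
  assumes "(\<lambda>x. f (z + x)) has_fps_expansion H"
  shows "(Dz ^^ n) f z = (1 / (2 * of_real pi * \<i>)) ^ n * (fact n * fps_nth H n)"
proof -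
  define \<kappa> where "\<kappa> = 1 / (2 * of_real pi * \<i>)"
  have "(\<lambda>x. (Dz ^^ n) f (z + x)) has_fps_expansion (fps_const (\<kappa> ^ n) * (fps_deriv ^^ n) H)"
  proof (induction n)
    case 0
    show ?case using assms by simp
  next
    case (Suc n)
    have "(\<lambda>x. \<kappa> * deriv (\<lambda>x. (Dz ^^ n) f (z + x)) x) has_fps_expansion
        (fps_const \<kappa> * fps_deriv (fps_const (\<kappa> ^ n) * (fps_deriv ^^ n) H))"
      by (intro has_fps_expansion_cmult_left has_fps_expansion_deriv Suc)
    moreover have "(\<lambda>x. (Dz ^^ Suc n) f (z + x)) = (\<lambda>x. \<kappa> * deriv (\<lambda>x. (Dz ^^ n) f (z + x)) x)"
      unfolding deriv_translate by (simp add: Dz_def \<kappa>_def)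
    moreover have "fps_const \<kappa> * fps_deriv (fps_const (\<kappa> ^ n) * (fps_deriv ^^ n) H)
        = fps_const (\<kappa> ^ Suc n) * (fps_deriv ^^ Suc n) H"
      by (simp flip: fps_const_mult add: mult.assoc)
    ultimately show ?case by (simp only:)
  qed
  from has_fps_expansion_imp_0_eq_fps_nth_0[OF this]
  have "(Dz ^^ n) f z = \<kappa> ^ n * fps_nth ((fps_deriv ^^ n) H) 0" by simp
  also have "fps_nth ((fps_deriv ^^ n) H) 0 = fact n * fps_nth H n"
    by (induction n arbitrary: H) (simp_all add: funpow_Suc_right algebra_simps del: funpow.simps)
  finally show ?thesis by (simp add: \<kappa>_def)
qed

lemma epow_add: "epow r (z + x) = epow r z * epow r x"
  by (simp add: epow_def distrib_left flip: exp_add)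

lemma epow_quotient_has_fps_expansion:
  fixes r :: rat and l :: nat and z :: complex
  defines "w \<equiv> epow (of_nat l) z"
  assumes l: "l \<ge> 1" and w: "w \<noteq> 1"
  shows "(\<lambda>x. epow r (z + x) / (epow (of_nat l) (z + x) - 1)) has_fps_expansion
    fps_const (epow r z) * (fps_exp (of_rat r / of_nat l) / (fps_const w * fps_exp 1 - 1)
      oo (fps_const (2 * of_real pi * \<i> * of_nat l) * fps_X))"
proof -
  define a where "a = complex_of_rat r / of_nat l"
  define \<kappa> where "\<kappa> = 2 * of_real pi * \<i> * complex_of_nat l"
  have "fps_nth (fps_const w * fps_exp 1 - 1) 0 \<noteq> 0" using w by simp
  hence quotient: "(\<lambda>y. exp (a * y) / (w * exp y - 1))
      has_fps_expansion (fps_exp a / (fps_const w * fps_exp 1 - 1))"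
    by (intro fps_expansion_intros)
  have linear: "(\<lambda>x. \<kappa> * x) has_fps_expansion (fps_const \<kappa> * fps_X)"
    by (intro fps_expansion_intros)
  have "(\<lambda>x. epow r z * ((\<lambda>y. exp (a * y) / (w * exp y - 1)) \<circ> (\<lambda>x. \<kappa> * x)) x) has_fps_expansion
      fps_const (epow r z) * (fps_exp a / (fps_const w * fps_exp 1 - 1) oo (fps_const \<kappa> * fps_X))"
    by (rule has_fps_expansion_cmult_left[OF has_fps_expansion_compose[OF quotient linear]]) simp
  moreover have "epow r x = exp (a * (\<kappa> * x))" "epow (of_nat l) x = exp (\<kappa> * x)" for x
    using l by (simp_all add: epow_def a_def \<kappa>_def mult_ac)
  ultimately show ?thesis unfolding a_def \<kappa>_def by (simp add: epow_add w_def)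
qed

definition sin_quotient :: "rat \<Rightarrow> nat \<Rightarrow> complex \<Rightarrow> complex" where
  "sin_quotient d l = (\<lambda>w. sin (2 * of_real pi * of_rat d * w) / (1 - epow (of_nat l) w))"

lemma two_i_sin_eq_epow_diff: "2 * \<i> * sin (2 * of_real pi * of_rat d * z) = epow d z - epow (- d) z"
  unfolding sin_exp_eq epow_def by (simp add: of_rat_minus mult_ac)

lemma sin_quotient_eq_epow_quotients:
  "sin_quotient d l u
    = - 1 / (2 * \<i>) * (epow d u / (epow (of_nat l) u - 1) - epow (- d) u / (epow (of_nat l) u - 1))"
proof -
  define k where "k = epow (of_nat l) u - 1"
  have "sin_quotient d l u = (epow d u - epow (- d) u) / (2 * \<i>) / - k"
    unfolding two_i_sin_eq_epow_diff[symmetric] by (simp add: sin_quotient_def k_def)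
  also have "\<dots> = - 1 / (2 * \<i>) * (epow d u / k - epow (- d) u / k)"
    by (simp flip: diff_divide_distrib)
  finally show ?thesis by (simp add: k_def)
qed

lemma Dz_funpow_sin_quotient:
  fixes d :: rat and l :: nat and z :: complex
  defines "\<beta> \<equiv> \<lambda>r. apostol_bernoulli_fps (epow (of_nat l) z) (of_rat r / of_nat l)"
  assumes l: "l \<ge> 1" and w: "epow (of_nat l) z \<noteq> 1"
  shows "2 * \<i> * (Dz ^^ n) (sin_quotient d l) z
    = - (fact n * of_nat l ^ n
        * (epow d z * fps_nth (\<beta> d) (Suc n) - epow (- d) z * fps_nth (\<beta> (- d)) (Suc n)))"
proof -
  define \<kappa> where "\<kappa> = 2 * complex_of_real pi * \<i>"
  define Q where "Q = (\<lambda>r. fps_const (epow r z)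
      * (fps_exp (of_rat r / of_nat l) / (fps_const (epow (of_nat l) z) * fps_exp 1 - 1)
      oo (fps_const (\<kappa> * of_nat l) * fps_X)))"
  have Q: "(\<lambda>x. epow r (z + x) / (epow (of_nat l) (z + x) - 1)) has_fps_expansion Q r" for r
    unfolding Q_def \<kappa>_def by (rule epow_quotient_has_fps_expansion[OF l w])
  have Q_nth: "fps_nth (Q r) n = epow r z * (\<kappa> * of_nat l) ^ n * fps_nth (\<beta> r) (Suc n)" for r
    by (simp add: Q_def \<beta>_def fps_compose_linear apostol_bernoulli_fps_neq_1[OF w])
  have "(\<lambda>x. sin_quotient d l (z + x)) has_fps_expansion fps_const (- 1 / (2 * \<i>)) * (Q d - Q (- d))"
    unfolding sin_quotient_eq_epow_quotients
    by (intro has_fps_expansion_cmult_left has_fps_expansion_diff Q)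
  from Dz_funpow_eq_fps_nth[OF this, of n]
  have "2 * \<i> * (Dz ^^ n) (sin_quotient d l) z
      = (2 * \<i> * (- 1 / (2 * \<i>)))
          * ((1 / \<kappa>) ^ n * (fact n * (fps_nth (Q d) n - fps_nth (Q (- d)) n)))"
    unfolding fps_mult_left_const_nth fps_sub_nth \<kappa>_def by (simp only: mult_ac)
  also have "2 * \<i> * (- 1 / (2 * \<i>)) = - 1" by simp
  also have "- 1 * ((1 / \<kappa>) ^ n * (fact n * (fps_nth (Q d) n - fps_nth (Q (- d)) n)))
      = - ((1 / \<kappa>) ^ n * \<kappa> ^ n * (fact n * of_nat l ^ n
      * (epow d z * fps_nth (\<beta> d) (Suc n) - epow (- d) z * fps_nth (\<beta> (- d)) (Suc n))))"
    unfolding Q_nth by (simp add: power_mult_distrib algebra_simps)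
  also have "(1 / \<kappa>) ^ n * \<kappa> ^ n = 1" by (simp add: \<kappa>_def flip: power_mult_distrib)
  finally show ?thesis by simp
qed

section \<open>Asymptotics of the partial theta function\<close>

lemma of_real_of_rat [simp]: "complex_of_real (of_rat q) = of_rat q"
  by (induction q) (simp add: of_rat_rat)

lemma F_eq_shifted_gauss_sum:
  assumes l: "l \<ge> 1" and t: "t > 0"
  shows "F d l z (\<i> * of_real t)
    = epow d z * shifted_gauss_sum (epow (of_nat l) z) (of_rat d / real l) (2 * pi * (real l)\<^sup>2 * t)"
proof -
  have summand: "epow (of_nat l * of_nat n + d) z * epow ((of_nat l * of_nat n + d)\<^sup>2) (\<i> * of_real t)
      = epow d z * (epow (of_nat l) z ^ n
          * of_real (exp (- (2 * pi * (real l)\<^sup>2 * t) * (real n + of_rat d / real l)\<^sup>2)))" for n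
  proof -
    define Q where "Q = real l * real n + of_rat d"
    have "epow (of_nat l * of_nat n + d) z = epow d z * epow (of_nat l) z ^ n"
      by (simp add: epow_def of_rat_add of_rat_mult exp_add[symmetric] exp_of_nat_mult[symmetric]
          algebra_simps)
    moreover have "epow ((of_nat l * of_nat n + d)\<^sup>2) (\<i> * of_real t)
        = exp (of_real (- (2 * pi * t * Q\<^sup>2)))"
      by (simp add: epow_def Q_def of_rat_add of_rat_mult of_rat_power mult_ac)
    moreover have "2 * pi * t * Q\<^sup>2 = 2 * pi * (real l)\<^sup>2 * t * (real n + of_rat d / real l)\<^sup>2"
    proof -
      have "Q = real l * (real n + of_rat d / real l)" using l by (simp add: Q_def distrib_left)
      thus ?thesis by (simp add: power_mult_distrib)
    qed
    ultimately show ?thesis by (simp flip: exp_of_real)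
  qed
  have "epow (of_nat l) z \<noteq> 0" by (simp add: epow_def)
  moreover have "2 * pi * (real l)\<^sup>2 * t > 0" using l t by simp
  ultimately show ?thesis
    unfolding F_def shifted_gauss_sum_def summand by (intro suminf_mult shifted_gauss_summable)
qed

text \<open>For \<open>X = shifted_gauss_sum (\<zeta>\<^sup>l)\<close> this is \<open>G d l z (\<i> t)\<close>.\<close>

definition theta_antisym :: "rat \<Rightarrow> nat \<Rightarrow> complex \<Rightarrow> (real \<Rightarrow> real \<Rightarrow> complex) \<Rightarrow> real \<Rightarrow> complex" where
  "theta_antisym d l z X t = epow d z * X (of_rat d / real l) (2 * pi * (real l)\<^sup>2 * t)
     - epow (- d) z * X (- (of_rat d / real l)) (2 * pi * (real l)\<^sup>2 * t)"

lemma theta_antisym_diff: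
  "theta_antisym d l z (\<lambda>a s. X a s - Y a s) t = theta_antisym d l z X t - theta_antisym d l z Y t"
  by (simp add: theta_antisym_def algebra_simps)

lemma theta_antisym_add:
  "theta_antisym d l z (\<lambda>a s. X a s + Y a s) t = theta_antisym d l z X t + theta_antisym d l z Y t"
  by (simp add: theta_antisym_def algebra_simps)

lemma theta_antisym_bigo:
  fixes X :: "real \<Rightarrow> real \<Rightarrow> complex"
  assumes l: "l \<ge> 1" and X: "\<And>a. X a \<in> O[at_right 0](\<lambda>s. of_real s ^ n)"
  shows "theta_antisym d l z X \<in> O[at_right 0](\<lambda>t. of_real t ^ n)"
proof -
  define p where "p = 2 * pi * (real l)\<^sup>2"
  have "p > 0" using l by (simp add: p_def)
  hence "filterlim (\<lambda>t. p * t) (at_right 0) (at_right 0)"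
    by (intro filterlim_times_pos[OF filterlim_ident]) auto
  hence "(\<lambda>t. X a (p * t)) \<in> O[at_right 0](\<lambda>t. of_real (p * t) ^ n)" for a
    using landau_o.big.compose[OF X] by blast
  hence "(\<lambda>t. X a (p * t)) \<in> O[at_right 0](\<lambda>t. of_real t ^ n)" for a
    using \<open>p > 0\<close> by (simp add: power_mult_distrib)
  thus ?thesis unfolding theta_antisym_def p_def[symmetric] by (intro sum_in_bigo) simp_all
qed

lemma G_asymp_of_shifted_gauss_sum:
  assumes l: "l \<ge> 1"
    and X: "\<And>a. (\<lambda>s. shifted_gauss_sum (epow (of_nat l) z) a s - X a s)
        \<in> O[at_right 0](\<lambda>s. of_real s ^ n)"
    and M: "\<And>t. t > 0 \<Longrightarrow> M t = theta_antisym d l z X t"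
  shows "(\<lambda>t. G d l z (\<i> * of_real t) - M t) \<in> O[at_right 0](\<lambda>t. of_real t ^ n)"
proof -
  have G_eq: "G d l z (\<i> * of_real t)
      = theta_antisym d l z (shifted_gauss_sum (epow (of_nat l) z)) t" if "t > 0" for t
    unfolding G_def F_eq_shifted_gauss_sum[OF l that] theta_antisym_def by (simp add: of_rat_minus)
  have "\<forall>\<^sub>F t in at_right 0. G d l z (\<i> * of_real t) - M t
      = theta_antisym d l z (\<lambda>a s. shifted_gauss_sum (epow (of_nat l) z) a s - X a s) t"
    using eventually_at_right_less[of 0] by eventually_elim (simp add: G_eq theta_antisym_diff M)
  from landau_o.big.in_cong[OF this] theta_antisym_bigo[OF l X, of d z] show ?thesis by simp
qed

lemma epow_of_nat_eq_1_iff: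
  assumes "l \<ge> 1"
  shows "epow (of_nat l) z = 1 \<longleftrightarrow> z \<in> frac_ints l"
proof -
  have "epow (of_nat l) z = 1 \<longleftrightarrow> (\<exists>n::int. of_nat l * z = of_int n)"
    unfolding epow_def exp_eq_1 by (auto simp: complex_eq_iff)
  also have "\<dots> \<longleftrightarrow> z \<in> frac_ints l"
    using assms by (auto simp: frac_ints_def field_simps)
  finally show ?thesis .
qed

lemma norm_epow_of_nat: "norm (epow (of_nat l) z) = exp (- (2 * pi * real l * Im z))"
  by (simp add: epow_def norm_exp_eq_Re)

lemma bernoulli_poly_eq_fps_nth: "bernoulli_poly n x = fact n * fps_nth (apostol_bernoulli_fps 1 x) n"
  by (simp add: bernoulli_poly_def apostol_bernoulli_fps_def)

lemma bernoulli_poly_0: "bernoulli_poly 0 x = 1"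
proof -
  have "fps_nth (Abs_fps (\<lambda>n. bernoulli_poly n x / fact n) * (fps_exp 1 - 1)) 1 = 1"
    unfolding bernoulli_poly_genfun by simp
  thus ?thesis by (simp add: fps_mult_nth)
qed

definition sin_quotient_expansion :: "rat \<Rightarrow> nat \<Rightarrow> nat \<Rightarrow> complex \<Rightarrow> real \<Rightarrow> complex" where
  "sin_quotient_expansion d l N z t = 2 * \<i> * (\<Sum>a=0..N.
     (Dz ^^ (2 * a)) (sin_quotient d l) z * ((- 2 * of_real pi * of_real t) ^ a / fact a))"

lemma theta_antisym_expansion_sin_quotient:
  fixes z :: complex
  assumes l: "l \<ge> 1" and w: "epow (of_nat l) z \<noteq> 1"
  shows "theta_antisym d l z (\<lambda>a. gauss_sum_expansion (epow (of_nat l) z) a N) t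
    = sin_quotient_expansion d l N z t"
proof -
  define s where "s = 2 * pi * (real l)\<^sup>2 * t"
  define \<beta> where "\<beta> = (\<lambda>a. fps_nth (apostol_bernoulli_fps (epow (of_nat l) z) a))"
  define a where "a = complex_of_rat d / of_nat l"
  define b where "b = (\<lambda>k. epow d z * \<beta> a (Suc (2 * k)) - epow (- d) z * \<beta> (- a) (Suc (2 * k)))"
  have "complex_of_real (- s) = (- 2 * of_real pi * of_real t) * (of_nat l)\<^sup>2" by (simp add: s_def)
  hence s_pow: "complex_of_real ((- s) ^ k)
      = (- 2 * of_real pi * of_real t) ^ k * of_nat l ^ (2 * k)" for k
    unfolding of_real_power by (simp only: power_mult_distrib power_mult)
  define c where "c = (\<lambda>k. complex_of_real ((- s) ^ k * fact (2 * k) / fact k))"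
  have "2 * \<i> * ((Dz ^^ (2 * k)) (sin_quotient d l) z * ((- 2 * of_real pi * of_real t) ^ k / fact k))
      = - (b k * c k)" for k
  proof -
    have "2 * \<i> * (Dz ^^ (2 * k)) (sin_quotient d l) z = - (fact (2 * k) * of_nat l ^ (2 * k) * b k)"
      using Dz_funpow_sin_quotient[OF l w, of "2 * k" d]
      by (simp add: b_def \<beta>_def a_def of_rat_minus)
    thus ?thesis unfolding c_def of_real_mult of_real_divide s_pow
      by (simp add: mult.assoc[symmetric])
  qed
  hence "sin_quotient_expansion d l N z t = - (\<Sum>k\<le>N. b k * c k)"
    by (simp add: sin_quotient_expansion_def sum_distrib_left sum_negf atLeast0AtMost)
  also have "\<dots> = epow d z * - (\<Sum>k\<le>N. \<beta> a (Suc (2 * k)) * c k)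
      - epow (- d) z * - (\<Sum>k\<le>N. \<beta> (- a) (Suc (2 * k)) * c k)"
    unfolding b_def left_diff_distrib sum_subtractf sum_distrib_left mult.assoc
    by (simp add: sum_distrib_left)
  also have "\<dots> = theta_antisym d l z (\<lambda>a. gauss_sum_expansion (epow (of_nat l) z) a N) t"
  proof -
    have "gauss_sum_expansion (epow (of_nat l) z) x N s
        = - (\<Sum>k\<le>N. \<beta> (of_real x) (Suc (2 * k)) * c k)" for x
      by (simp add: gauss_sum_expansion_def \<beta>_def c_def apostol_bernoulli_fps_neq_1[OF w])
    thus ?thesis by (simp add: theta_antisym_def s_def[symmetric] a_def)
  qed
  finally show ?thesis ..
qed

lemma gauss_sum_expansion_1:
  "gauss_sum_expansion 1 a N s = of_real (sqrt (pi / s) / 2)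
    - (\<Sum>k=0..N. bernoulli_poly (2 * k + 1) (of_real a)
        * (of_real (- s) ^ k / (fact k * of_nat (2 * k + 1))))"
proof -
  have "fps_nth (apostol_bernoulli_fps 1 x) (2 * k + 1) * of_real ((- s) ^ k * fact (2 * k) / fact k)
      = bernoulli_poly (2 * k + 1) x * (of_real (- s) ^ k / (fact k * of_nat (2 * k + 1)))" for k x
  proof -
    have "fact (2 * k + 1) = (of_nat (2 * k + 1) * fact (2 * k) :: complex)" by simp
    moreover have "of_nat (2 * k + 1) \<noteq> (0 :: complex)" by (simp only: of_nat_eq_0_iff)
    ultimately show ?thesis unfolding bernoulli_poly_eq_fps_nth
      by (simp del: of_nat_add of_nat_Suc fact_Suc of_nat_mult of_real_minus)
  qed
  moreover have "fps_nth (apostol_bernoulli_fps 1 (of_real a)) 0 = 1"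
    using bernoulli_poly_0[of "of_real a"] by (simp add: bernoulli_poly_eq_fps_nth)
  ultimately show ?thesis unfolding gauss_sum_expansion_def atLeast0AtMost by simp
qed

definition bernoulli_expansion :: "rat \<Rightarrow> nat \<Rightarrow> nat \<Rightarrow> complex \<Rightarrow> real \<Rightarrow> complex" where
  "bernoulli_expansion d l N z t
   = \<i> * sin (2 * of_real pi * of_rat d * z) / (of_nat l * of_real ((2 * t) powr (1 / 2)))
     - (\<Sum>a=0..N. (epow d z * bernoulli_poly (2 * a + 1) (of_rat d / of_nat l)
          - epow (- d) z * bernoulli_poly (2 * a + 1) (- (of_rat d / of_nat l)))
        * ((- 2 * of_real pi * (of_nat l)\<^sup>2 * of_real t) ^ a / (fact a * of_nat (2 * a + 1))))"

lemma theta_antisym_expansion_bernoulli: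
  fixes z :: complex
  assumes l: "l \<ge> 1" and t: "t > 0"
  shows "theta_antisym d l z (\<lambda>a. gauss_sum_expansion 1 a N) t = bernoulli_expansion d l N z t"
proof -
  define s where "s = 2 * pi * (real l)\<^sup>2 * t"
  define p where "p = 1 / (of_nat l * complex_of_real ((2 * t) powr (1 / 2)))"
  define B where "B = (\<lambda>x. \<Sum>k=0..N.
    bernoulli_poly (2 * k + 1) x * (complex_of_real (- s) ^ k / (fact k * of_nat (2 * k + 1))))"
  have "sqrt (pi / s) = 1 / (real l * (2 * t) powr (1 / 2))"
    using l t by (simp add: s_def real_sqrt_divide real_sqrt_mult powr_half_sqrt)
  hence root: "complex_of_real (sqrt (pi / s) / 2) = p / 2" by (simp add: p_def)
  have "- 2 * of_real pi * (of_nat l)\<^sup>2 * of_real t = complex_of_real (- s)" by (simp add: s_def)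
  hence "(\<Sum>k=0..N.
        (epow d z * bernoulli_poly (2 * k + 1) x - epow (- d) z * bernoulli_poly (2 * k + 1) (- x))
      * ((- 2 * of_real pi * (of_nat l)\<^sup>2 * of_real t) ^ k / (fact k * of_nat (2 * k + 1))))
      = epow d z * B x - epow (- d) z * B (- x)" for x
    unfolding B_def left_diff_distrib sum_subtractf sum_distrib_left by (simp only: mult.assoc)
  moreover have "\<i> * sin (2 * of_real pi * of_rat d * z) / (of_nat l * of_real ((2 * t) powr (1 / 2)))
      = epow d z * (p / 2) - epow (- d) z * (p / 2)"
    unfolding p_def left_diff_distrib[symmetric] two_i_sin_eq_epow_diff[symmetric] by simp
  moreover have "theta_antisym d l z (\<lambda>a. gauss_sum_expansion 1 a N) t
      = epow d z * (p / 2 - B (of_rat d / of_nat l))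
        - epow (- d) z * (p / 2 - B (- (of_rat d / of_nat l)))"
    unfolding theta_antisym_def s_def[symmetric] gauss_sum_expansion_1 root B_def by simp
  ultimately show ?thesis
    unfolding bernoulli_expansion_def by (simp only: right_diff_distrib) (simp only: algebra_simps)
qed

lemma epow_mult_gauss_dual_term:
  assumes l: "l \<ge> 1"
  shows "epow d z * gauss_dual_term (of_rat d / real l) (of_nat l * z) s m = of_real (sqrt (pi / s))
    * exp (- (of_real (pi\<^sup>2) * (of_nat l * z - of_int m)\<^sup>2 / of_real s))
        * epow d (of_int m / of_nat l)"
proof -
  have "epow d z
        * exp (- (2 * of_real pi * \<i> * of_real (of_rat d / real l) * (of_nat l * z - of_int m)))
      = epow d (of_int m / of_nat l)"
    using l by (simp add: epow_def right_diff_distrib flip: exp_add)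
  thus ?thesis unfolding gauss_dual_term_def by (simp add: exp_diff exp_minus field_simps)
qed

lemma theta_antisym_gauss_dual_sum:
  fixes z :: complex
  assumes l: "l \<ge> 1" and t: "t > 0"
  shows "theta_antisym d l z (\<lambda>a s. sum (gauss_dual_term a (of_nat l * z) s) A) t
    = 2 * \<i> * of_real ((2 * (real l)\<^sup>2 * t) powr (- 1 / 2))
      * (\<Sum>m\<in>A. exp (- (of_real pi * (of_nat l * z - of_int m)\<^sup>2 / (2 * (of_nat l)\<^sup>2 * of_real t)))
           * sin (2 * of_real pi * of_rat d / of_nat l * of_int m))"
proof -
  define s where "s = 2 * pi * (real l)\<^sup>2 * t"
  define Q where "Q = (\<lambda>m. exp (- (of_real (pi\<^sup>2) * (of_nat l * z - of_int m)\<^sup>2 / of_real s)))"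
  have "pi / s = inverse (2 * (real l)\<^sup>2 * t)" by (simp add: s_def divide_simps)
  hence root: "sqrt (pi / s) = (2 * (real l)\<^sup>2 * t) powr (- 1 / 2)"
    using l t
    by (simp only: real_sqrt_inverse) (simp add: real_sqrt_inverse powr_minus powr_half_sqrt)
  have Q_eq: "Q m
      = exp (- (of_real pi * (of_nat l * z - of_int m)\<^sup>2 / (2 * (of_nat l)\<^sup>2 * of_real t)))" for m
    by (simp add: Q_def s_def power2_eq_square mult.assoc)
  have "theta_antisym d l z (\<lambda>a s. sum (gauss_dual_term a (of_nat l * z) s) A) t
      = (\<Sum>m\<in>A. epow d z * gauss_dual_term (of_rat d / real l) (of_nat l * z) s m)
      - (\<Sum>m\<in>A. epow (- d) z * gauss_dual_term (of_rat (- d) / real l) (of_nat l * z) s m)"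
    by (simp add: theta_antisym_def s_def sum_distrib_left of_rat_minus)
  also have "\<dots> = (\<Sum>m\<in>A. of_real (sqrt (pi / s)) * Q m
      * (epow d (of_int m / of_nat l) - epow (- d) (of_int m / of_nat l)))"
    unfolding epow_mult_gauss_dual_term[OF l] Q_def by (simp add: right_diff_distrib sum_subtractf)
  also have "\<dots> = 2 * \<i> * of_real (sqrt (pi / s))
      * (\<Sum>m\<in>A. Q m * sin (2 * of_real pi * of_rat d / of_nat l * of_int m))"
    unfolding two_i_sin_eq_epow_diff[symmetric] by (simp add: sum_distrib_left mult_ac)
  finally show ?thesis by (simp only: root Q_eq)
qed

definition dual_theta_sum :: "rat \<Rightarrow> nat \<Rightarrow> int \<Rightarrow> complex \<Rightarrow> real \<Rightarrow> complex" where
  "dual_theta_sum d l j z0 t = 2 * \<i> * of_real ((2 * (real l)\<^sup>2 * t) powr (- 1 / 2))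
     * exp (- (of_real pi * z0\<^sup>2) / (2 * (of_nat l)\<^sup>2 * of_real t))
     * (\<Sum>n | \<bar>real_of_int n + Re z0\<bar> \<le> \<bar>Im z0\<bar>.
          exp (- (of_real pi * (of_int n)\<^sup>2) / (2 * (of_nat l)\<^sup>2 * of_real t)
               - of_real pi * z0 * of_int n / ((of_nat l)\<^sup>2 * of_real t))
            * sin (2 * of_real pi * of_rat d / of_nat l * of_int (j - n)))"

text \<open>Here \<open>n = j - m\<close>, so that \<open>lz - m = z\<^sub>0 + n\<close>.\<close>

lemma theta_antisym_gauss_dual_sum_nondecaying:
  fixes z z0 :: complex
  assumes l: "l \<ge> 1" and t: "t > 0" and z: "of_nat l * z = z0 + of_int j"
  shows "theta_antisym d l z
      (\<lambda>a s. sum (gauss_dual_term a (of_nat l * z) s) (nondecaying_ints (of_nat l * z))) t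
    = dual_theta_sum d l j z0 t"
proof -
  have bij: "bij_betw (\<lambda>n. j - n) {n. \<bar>real_of_int n + Re z0\<bar> \<le> \<bar>Im z0\<bar>}
      (nondecaying_ints (of_nat l * z))"
    by (rule bij_betw_byWitness[where f' = "\<lambda>m. j - m"]) (auto simp: nondecaying_ints_def z)
  have quadratic: "exp (- (of_real pi * (of_nat l * z - of_int (j - n))\<^sup>2
        / (2 * (of_nat l)\<^sup>2 * of_real t)))
      = exp (- (of_real pi * z0\<^sup>2) / (2 * (of_nat l)\<^sup>2 * of_real t))
        * exp (- (of_real pi * (of_int n)\<^sup>2) / (2 * (of_nat l)\<^sup>2 * of_real t)
             - of_real pi * z0 * of_int n / ((of_nat l)\<^sup>2 * of_real t))" for n
    unfolding exp_add[symmetric] z using l t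
    by (intro arg_cong[of _ _ exp]) (simp add: power2_eq_square field_simps)
  show ?thesis
    unfolding theta_antisym_gauss_dual_sum[OF l t] dual_theta_sum_def
    unfolding sum.reindex_bij_betw[OF bij, symmetric] quadratic
    by (simp only: sum_distrib_left mult.assoc)
qed

lemma G_asymp_closed_upper_half_plane:
  fixes d :: rat
  assumes l: "l \<ge> 1" and "Im z \<ge> 0"
    and M: "\<And>t. t > 0 \<Longrightarrow> M t = theta_antisym d l z (\<lambda>a. gauss_sum_expansion (epow (of_nat l) z) a N) t"
  shows "(\<lambda>t. G d l z (\<i> * of_real t) - M t) \<in> O[at_right 0](\<lambda>t. of_real t ^ (N + 1))"
proof (rule G_asymp_of_shifted_gauss_sum[OF l _ M])
  have "norm (epow (of_nat l) z) \<le> 1" using assms by (simp add: norm_epow_of_nat)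
  thus "(\<lambda>s. shifted_gauss_sum (epow (of_nat l) z) a s
      - gauss_sum_expansion (epow (of_nat l) z) a N s)
      \<in> O[at_right 0](\<lambda>s. of_real s ^ (N + 1))" for a
    by (rule shifted_gauss_sum_asymp_unit_disc)
qed

lemma G_asymp_closed_upper_half_plane_off_lattice:
  fixes d :: rat and z :: complex
  assumes l: "l \<ge> 1" and "Im z \<ge> 0" and "z \<notin> frac_ints l"
  shows "(\<lambda>t. G d l z (\<i> * of_real t) - sin_quotient_expansion d l N z t)
    \<in> O[at_right 0](\<lambda>t. of_real t ^ (N + 1))"
  using assms epow_of_nat_eq_1_iff[OF l, of z]
  by (intro G_asymp_closed_upper_half_plane[OF l] theta_antisym_expansion_sin_quotient[symmetric])
     auto

lemma G_asymp_frac_ints: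
  fixes d :: rat and z :: complex
  assumes l: "l \<ge> 1" and z: "z \<in> frac_ints l"
  shows "(\<lambda>t. G d l z (\<i> * of_real t) - bernoulli_expansion d l N z t)
    \<in> O[at_right 0](\<lambda>t. of_real t ^ (N + 1))"
proof (rule G_asymp_closed_upper_half_plane[OF l])
  show "Im z \<ge> 0" using z by (auto simp: frac_ints_def)
  have "epow (of_nat l) z = 1" using epow_of_nat_eq_1_iff[OF l] z by blast
  thus "bernoulli_expansion d l N z t
      = theta_antisym d l z (\<lambda>a. gauss_sum_expansion (epow (of_nat l) z) a N) t" if "t > 0" for t
    by (simp add: theta_antisym_expansion_bernoulli[OF l that])
qed

lemma G_asymp_lower_half_plane:
  fixes d :: rat and z z0 :: complex
  assumes l: "l \<ge> 1" and z: "z = (z0 + of_int j) / of_nat l" and Im: "Im z < 0"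
  shows "(\<lambda>t. G d l z (\<i> * of_real t)
      - (dual_theta_sum d l j z0 t + sin_quotient_expansion d l N z t))
    \<in> O[at_right 0](\<lambda>t. of_real t ^ (N + 1))"
proof (rule G_asymp_of_shifted_gauss_sum[OF l])
  let ?w = "epow (of_nat l) z" and ?\<zeta> = "of_nat l * z"
  have w: "?w = exp (2 * of_real pi * \<i> * ?\<zeta>)" by (simp add: epow_def mult.assoc)
  have "Im ?\<zeta> < 0" using l Im by (simp add: mult_pos_neg)
  thus "(\<lambda>s. shifted_gauss_sum ?w a s
      - (sum (gauss_dual_term a ?\<zeta> s) (nondecaying_ints ?\<zeta>) + gauss_sum_expansion ?w a N s))
      \<in> O[at_right 0](\<lambda>s. of_real s ^ (N + 1))" for a
    unfolding w by (rule shifted_gauss_sum_asymp_outside_unit_disc)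
  have "norm ?w > 1" unfolding norm_epow_of_nat using l Im by (simp add: mult_pos_neg)
  hence "?w \<noteq> 1" by auto
  note expansion = theta_antisym_expansion_sin_quotient[OF l this]
  have "?\<zeta> = z0 + of_int j" using l by (simp add: z)
  note dual = theta_antisym_gauss_dual_sum_nondecaying[OF l _ this]
  show "dual_theta_sum d l j z0 t + sin_quotient_expansion d l N z t
      = theta_antisym d l z (\<lambda>a s. sum (gauss_dual_term a ?\<zeta> s) (nondecaying_ints ?\<zeta>)
          + gauss_sum_expansion ?w a N s) t" if "t > 0" for t
    unfolding theta_antisym_add dual[OF that] expansion ..
qed

lemma abs_add_int_le_abs_eq_empty:
  fixes x y :: real
  assumes "\<bar>x\<bar> \<le> 1 / 2" "\<bar>x\<bar> > \<bar>y\<bar>"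
  shows "{n. \<bar>real_of_int n + x\<bar> \<le> \<bar>y\<bar>} = {}"
proof -
  have "\<bar>x\<bar> \<le> \<bar>real_of_int n + x\<bar>" for n
  proof (cases "n = 0")
    case False
    hence "\<bar>real_of_int n\<bar> \<ge> 1" by linarith
    thus ?thesis using assms(1) by linarith
  qed simp
  thus ?thesis using assms(2) by (auto simp: not_le intro: less_le_trans)
qed

theorem theorem5p1:
  fixes d :: rat and l :: nat and z z0 :: complex and x0 y0 :: real and j :: int and N :: nat
  assumes l: "l \<ge> 1"
    and z: "z = (z0 + of_int j) / of_nat l"
    and z0: "z0 = of_real x0 + \<i> * of_real y0"
    and x0: "- 1 / 2 < x0" "x0 \<le> 1 / 2"
  shows
    "(Im z > 0 \<or> (Im z < 0 \<and> \<bar>x0\<bar> > \<bar>y0\<bar>) \<or> z \<in> \<real> - frac_ints l \<longrightarrow>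
       (\<lambda>t::real. G d l z (\<i> * of_real t)
          - 2 * \<i> * (\<Sum>a=0..N.
              (Dz ^^ (2 * a)) (\<lambda>w. sin (2 * of_real pi * of_rat d * w) / (1 - epow (of_nat l) w)) z
                * ((- 2 * of_real pi * of_real t) ^ a / fact a)))
         \<in> O[at_right 0](\<lambda>t. of_real t ^ (N + 1)))
     \<and>
     (Im z < 0 \<and> \<bar>x0\<bar> \<le> \<bar>y0\<bar> \<longrightarrow>
       (\<lambda>t::real. G d l z (\<i> * of_real t)
          - (2 * \<i> * of_real ((2 * (real l)\<^sup>2 * t) powr (- 1 / 2))
               * exp (- (of_real pi * z0\<^sup>2) / (2 * (of_nat l)\<^sup>2 * of_real t))
               * (\<Sum>n | \<bar>real_of_int n + x0\<bar> \<le> \<bar>y0\<bar>.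
                    exp (- (of_real pi * (of_int n)\<^sup>2) / (2 * (of_nat l)\<^sup>2 * of_real t)
                         - of_real pi * z0 * of_int n / ((of_nat l)\<^sup>2 * of_real t))
                      * sin (2 * of_real pi * of_rat d / of_nat l * of_int (j - n)))
             + 2 * \<i> * (\<Sum>a=0..N.
                 (Dz ^^ (2 * a)) (\<lambda>w. sin (2 * of_real pi * of_rat d * w) / (1 - epow (of_nat l) w)) z
                   * ((- 2 * of_real pi * of_real t) ^ a / fact a))))
         \<in> O[at_right 0](\<lambda>t. of_real t ^ (N + 1)))
     \<and>
     (z \<in> frac_ints l \<longrightarrow>
       (\<lambda>t::real. G d l z (\<i> * of_real t)
          - (\<i> * sin (2 * of_real pi * of_rat d * z) / (of_nat l * of_real ((2 * t) powr (1 / 2)))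
             - (\<Sum>a=0..N.
                 (epow d z * bernoulli_poly (2 * a + 1) (of_rat d / of_nat l)
                   - epow (- d) z * bernoulli_poly (2 * a + 1) (- (of_rat d / of_nat l)))
                 * ((- 2 * of_real pi * (of_nat l)\<^sup>2 * of_real t) ^ a / (fact a * of_nat (2 * a + 1))))))
         \<in> O[at_right 0](\<lambda>t. of_real t ^ (N + 1)))"
proof (intro conjI impI, goal_cases no_dual_terms dual_terms lattice)
  have "Re z0 = x0" "Im z0 = y0" by (simp_all add: z0)
  note lower = G_asymp_lower_half_plane[OF l z, of d N,
      unfolded dual_theta_sum_def this sin_quotient_expansion_def sin_quotient_def]
  note upper = G_asymp_closed_upper_half_plane_off_lattice[OF l, of z d N,
      unfolded sin_quotient_expansion_def sin_quotient_def]
  {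
    case no_dual_terms
    show ?case
    proof (cases "Im z < 0")
      case True
      hence "\<bar>x0\<bar> > \<bar>y0\<bar>" using no_dual_terms by (auto simp: complex_is_Real_iff)
      hence "{n. \<bar>real_of_int n + x0\<bar> \<le> \<bar>y0\<bar>} = {}"
        using x0 by (intro abs_add_int_le_abs_eq_empty) auto
      thus ?thesis using lower[OF True] by simp
    next
      case False
      hence "z \<notin> frac_ints l" using no_dual_terms by (auto simp: frac_ints_def)
      thus ?thesis using upper False by simp
    qed
  next
    case dual_terms
    thus ?case using lower by blast
  next
    case lattice
    thus ?case using G_asymp_frac_ints[OF l] by (simp only: bernoulli_expansion_def)
  }
qed

end
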